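(* Let $\{\alpha^t\}_{t\ge 0}$ be generated by the block-approximation descent method described in the context, started at a feasible $\alpha^0\in\Omega$, with line-search parameters $\beta,\tau\in(0,1)$, with either line search variant, and with every sub-problem solved exactly (that is, $\Delta\alpha^t$ is the minimizer of $Q^{\alpha^t}_{B_t}$ for every $t$). Suppose that: (i) $f$ satisfies the Kurdyka–Łojasiewicz inequality with exponent $1/2$ for some $\mu>0$, i.e. $$f(\alpha)-f^*\le \frac{\min_{\hat s\in\partial f(\alpha)}\|\hat s\|^2}{2\mu}\quad\text{for all }\alpha\in\Omega$$ (the right-hand side is $+\infty$ if $\partial f(\alpha)=\emptyset$); (ii) there is $C_3>0$ with $\|B_t\|\le C_3$ for all $t$; (iii) there are constants $C_1\le C_3$ (possibly nonpositive) and $C_2>0$ with $C_1+C_2>0$ such that, for all $t$, the smallest eigenvalue of $B_t$ is at least $C_1$ and $Q^{\alpha^t}_{B_t}$ is $C_2$-strongly convex. Then the dual objective values converge Q-linearly to $f^*$: for all $t\ge 0$, $$f(\alpha^{t+1})-f^*\le\left(1-\frac{\mu(C_1+C_2)\tau}{\mu(C_1+C_2)\tau+2\left(\frac{\|X^TX\|^2}{\sigma^2}+C_3^2\right)}\min\left\{1,\frac{\beta(1-\tau)\sigma(C_1+C_2)}{\|X^TX\|}\right\}\right)\bigl(f(\alpha^t)-f^*\bigr).$$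
   Context: Problem. Let $l,n\ge1$, $c_i\ge 1$, $X_i\in\mathbb{R}^{n\times c_i}$ for $i=1,\dots,l$, $N=\sum_i c_i$, $X=[X_1,\dots,X_l]\in\mathbb{R}^{n\times N}$. The primal problem is $\min_{w\in\mathbb{R}^n} f^P(w):=g(w)+\sum_{i=1}^l\xi_i(X_i^Tw)$, where $g$ (possibly extended-valued) is $\sigma$-strongly convex for some $\sigma>0$, each $\xi_i$ is convex, $f^P$ is proper, closed and convex, and the primal solution set is nonempty. Write $\xi(z)=\sum_{i}\xi_i(z_i)$ for $z=(z_1,\dots,z_l)\in\mathbb{R}^N$, $z_i\in\mathbb{R}^{c_i}$. For a function $h$, $h^*(u)=\sup_{z\in\mathrm{dom}(h)} z^Tu-h(z)$ is its convex conjugate, so $\xi^*(-\alpha)=\sum_i\xi_i^*(-\alpha_i)$. The dual problem is $\min_{\alpha\in\Omega} f(\alpha):=G^*(\alpha)+\xi^*(-\alpha)$, where $G^*(\alpha):=g^*(X\alpha)$ and $\Omega=\prod_{i=1}^l -\mathrm{dom}(\xi_i^* )\subseteq\mathbb{R}^N$; $f^*$ is its optimal value. ($g^*$ is finite and differentiable with $(1/\sigma)$-Lipschitz gradient.) Standing assumption: either $\xi$ is differentiable with $\rho$-Lipschitz continuous gradient for some $\rho>0$, or $\xi$ is $L$-Lipschitz continuous for some $L>0$. Method. At iteration $t$, given $\alpha^t\in\Omega$ and a symmetric matrix $B_t\in\mathbb{R}^{N\times N}$, let $$Q^{\alpha^t}_{B_t}(d):=\nabla G^*(\alpha^t)^Td+\tfrac12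 d^TB_td+\xi^*(-\alpha^t-d).$$ A direction $\Delta\alpha^t$ is obtained by (exactly or approximately) minimizing $Q^{\alpha^t}_{B_t}$, and $\alpha^{t+1}=\alpha^t+\eta_t\Delta\alpha^t$. The step size $\eta_t$ is chosen by one of two variants: Variant I (backtracking): $\eta_t=\beta^i$ for the smallest integer $i\ge0$ such that $\eta=\beta^i$ satisfies $f(\alpha^t+\eta\Delta\alpha^t)\le f(\alpha^t)+\eta\tau\Delta_t$, where $\Delta_t:=\nabla G^*(\alpha^t)^T\Delta\alpha^t+\xi^*(-\alpha^t-\Delta\alpha^t)-\xi^*(-\alpha^t)$. Variant II (exact line search): $\eta_t\in\arg\min_{\eta\in\mathbb{R}} f(\alpha^t+\eta\Delta\alpha^t)$. $\|\cdot\|$ is the Euclidean norm for vectors and the spectral norm for matrices. A quotient with denominator $\|X^TX\|$ is read as $+\infty$ if $X=0$. *)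

theory Defs
  imports "HOL-Analysis.Analysis"
begin

subsection \<open>Extended-real-valued convex functions\<close>

definition effdom :: "('a \<Rightarrow> ereal) \<Rightarrow> 'a set" where
  "effdom h = {z. h z < \<infinity>}"

definition epi :: "('a \<Rightarrow> ereal) \<Rightarrow> ('a \<times> real) set" where
  "epi h = {(x, r). h x \<le> ereal r}"

definition proper_fun :: "('a \<Rightarrow> ereal) \<Rightarrow> bool" where
  "proper_fun h \<longleftrightarrow> (\<forall>x. h x \<noteq> -\<infinity>) \<and> (\<exists>x. h x \<noteq> \<infinity>)"

definition closed_fun :: "('a::topological_space \<Rightarrow> ereal) \<Rightarrow> bool" where
  "closed_fun h \<longleftrightarrow> closed (epi h)"

definition convex_fun :: "('a::real_vector \<Rightarrow> ereal) \<Rightarrow> bool" where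
  "convex_fun h \<longleftrightarrow> convex (epi h)"

text \<open>In \<open>ereal\<close>, \<open>0 * \<infinity> = 0\<close> and \<open>\<infinity> + (-\<infinity>) = \<infinity>\<close>, so that the following
  inequality has its usual meaning also at \<open>\<theta> = 0\<close>, \<open>\<theta> = 1\<close> and at points outside the
  effective domain.\<close>

definition strongly_convex_fun :: "real \<Rightarrow> ('a::real_normed_vector \<Rightarrow> ereal) \<Rightarrow> bool" where
  "strongly_convex_fun m h \<longleftrightarrow>
     (\<forall>x y. \<forall>\<theta>\<in>{0..1}.
        h ((1 - \<theta>) *\<^sub>R x + \<theta> *\<^sub>R y) + ereal (m / 2 * \<theta> * (1 - \<theta>) * (norm (x - y))\<^sup>2)
        \<le> ereal (1 - \<theta>) * h x + ereal \<theta> * h y)"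

text \<open>The convex conjugate of a function on a subspace \<open>S\<close>, with respect to the inner product
  of \<open>S\<close>.\<close>

definition conj_on :: "'a::real_inner set \<Rightarrow> ('a \<Rightarrow> ereal) \<Rightarrow> 'a \<Rightarrow> ereal" where
  "conj_on S h u = (SUP z\<in>S \<inter> effdom h. ereal (z \<bullet> u) - h z)"

abbreviation conjugate :: "('a::real_inner \<Rightarrow> ereal) \<Rightarrow> 'a \<Rightarrow> ereal" where
  "conjugate \<equiv> conj_on UNIV"

definition subdifferential :: "('a::real_inner \<Rightarrow> ereal) \<Rightarrow> 'a \<Rightarrow> 'a set" where
  "subdifferential h x = {s. \<forall>y. h x + ereal (s \<bullet> (y - x)) \<le> h y}"

definition gradient :: "('a::real_inner \<Rightarrow> real) \<Rightarrow> 'a \<Rightarrow> 'a" where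
  "gradient h x = (THE D. GDERIV h x :> D)"

definition lipschitz_smooth :: "real \<Rightarrow> ('a::real_inner \<Rightarrow> real) \<Rightarrow> bool" where
  "lipschitz_smooth \<rho> h \<longleftrightarrow>
     (\<exists>D. (\<forall>z. GDERIV h z :> D z) \<and> \<rho>-lipschitz_on UNIV D)"


subsection \<open>Matrices\<close>

definition spectral_norm :: "real ^ 'm ^ 'k \<Rightarrow> real" where
  "spectral_norm A = onorm ((*v) A)"

definition eigenvalues :: "real ^ 'k ^ 'k \<Rightarrow> real set" where
  "eigenvalues A = {c. \<exists>v. v \<noteq> 0 \<and> A *v v = c *\<^sub>R v}"

definition smallest_eigenvalue :: "real ^ 'k ^ 'k \<Rightarrow> real" where
  "smallest_eigenvalue A = Min (eigenvalues A)"


subsection \<open>The block structure\<close>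

text \<open>The type \<open>'k\<close> indexes the \<open>N\<close> coordinates, the type \<open>'l\<close> the \<open>l\<close> blocks, and
  \<open>blk\<close> maps a coordinate to its block, so that block \<open>i\<close> has
  \<open>c\<^sub>i = card {k. blk k = i}\<close> coordinates. The space of vectors of length \<open>c\<^sub>i\<close> is rendered as
  the coordinate subspace \<open>blk_space blk i\<close>, the component \<open>z\<^sub>i\<close> of \<open>z\<close> as
  \<open>blk_proj blk i z\<close>, and \<open>X\<^sub>i\<close> consists of the columns \<open>k\<close> of \<open>X\<close> with \<open>blk k = i\<close>; thus
  \<open>blk_proj blk i (transpose X *v w)\<close> is the product of the transpose of \<open>X\<^sub>i\<close> with \<open>w\<close>.
  Only the values of \<open>\<xi> i\<close> on \<open>blk_space blk i\<close> matter.\<close>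

definition blk_space :: "('k \<Rightarrow> 'l) \<Rightarrow> 'l \<Rightarrow> (real ^ 'k) set" where
  "blk_space blk i = {z. \<forall>k. blk k \<noteq> i \<longrightarrow> z $ k = 0}"

definition blk_proj :: "('k \<Rightarrow> 'l) \<Rightarrow> 'l \<Rightarrow> real ^ 'k \<Rightarrow> real ^ 'k" where
  "blk_proj blk i z = (\<chi> k. if blk k = i then z $ k else 0)"

definition xi_sum ::
  "('k \<Rightarrow> 'l::finite) \<Rightarrow> ('l \<Rightarrow> real ^ 'k \<Rightarrow> real) \<Rightarrow> real ^ 'k \<Rightarrow> real" where
  "xi_sum blk \<xi> z = (\<Sum>i\<in>UNIV. \<xi> i (blk_proj blk i z))"


subsection \<open>The primal and the dual problem\<close>

definition primal ::
  "(real ^ 'n \<Rightarrow> ereal) \<Rightarrow> ('k \<Rightarrow> 'l::finite) \<Rightarrow> ('l \<Rightarrow> real ^ 'k \<Rightarrow> real)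
     \<Rightarrow> real ^ 'k ^ 'n \<Rightarrow> real ^ 'n \<Rightarrow> ereal" where
  "primal g blk \<xi> X w = g w + ereal (\<Sum>i\<in>UNIV. \<xi> i (blk_proj blk i (transpose X *v w)))"

definition xi_conj ::
  "('k \<Rightarrow> 'l::finite) \<Rightarrow> ('l \<Rightarrow> real ^ 'k \<Rightarrow> real) \<Rightarrow> real ^ 'k \<Rightarrow> ereal" where
  "xi_conj blk \<xi> = conjugate (\<lambda>z. ereal (xi_sum blk \<xi> z))"

definition Gstar :: "(real ^ 'n \<Rightarrow> ereal) \<Rightarrow> real ^ 'k ^ 'n \<Rightarrow> real ^ 'k \<Rightarrow> ereal" where
  "Gstar g X \<alpha> = conjugate g (X *v \<alpha>)"

text \<open>Under the assumptions made on \<open>g\<close>, its conjugate is finite everywhere, so that passing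
  to real values loses nothing.\<close>

definition grad_Gstar ::
  "(real ^ 'n \<Rightarrow> ereal) \<Rightarrow> real ^ 'k ^ 'n \<Rightarrow> real ^ 'k \<Rightarrow> real ^ 'k" where
  "grad_Gstar g X \<alpha> = gradient (\<lambda>a. real_of_ereal (Gstar g X a)) \<alpha>"

definition dual ::
  "(real ^ 'n \<Rightarrow> ereal) \<Rightarrow> ('k \<Rightarrow> 'l::finite) \<Rightarrow> ('l \<Rightarrow> real ^ 'k \<Rightarrow> real)
     \<Rightarrow> real ^ 'k ^ 'n \<Rightarrow> real ^ 'k \<Rightarrow> ereal" where
  "dual g blk \<xi> X \<alpha> = Gstar g X \<alpha> + xi_conj blk \<xi> (- \<alpha>)"

definition dual_feasible ::
  "('k \<Rightarrow> 'l) \<Rightarrow> ('l \<Rightarrow> real ^ 'k \<Rightarrow> real) \<Rightarrow> (real ^ 'k) set" where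
  "dual_feasible blk \<xi> =
     {\<alpha>. \<forall>i. - blk_proj blk i \<alpha> \<in> effdom (conj_on (blk_space blk i) (\<lambda>z. ereal (\<xi> i z)))}"

definition dual_opt ::
  "(real ^ 'n \<Rightarrow> ereal) \<Rightarrow> ('k \<Rightarrow> 'l::finite) \<Rightarrow> ('l \<Rightarrow> real ^ 'k \<Rightarrow> real)
     \<Rightarrow> real ^ 'k ^ 'n \<Rightarrow> ereal" where
  "dual_opt g blk \<xi> X = (INF \<alpha>\<in>dual_feasible blk \<xi>. dual g blk \<xi> X \<alpha>)"

text \<open>The infimum over an empty subdifferential is \<open>\<infinity>\<close>; over a nonempty one it is attained,
  since subdifferentials are closed.\<close>

definition KL_half ::
  "(real ^ 'n \<Rightarrow> ereal) \<Rightarrow> ('k \<Rightarrow> 'l::finite) \<Rightarrow> ('l \<Rightarrow> real ^ 'k \<Rightarrow> real)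
     \<Rightarrow> real ^ 'k ^ 'n \<Rightarrow> real \<Rightarrow> bool" where
  "KL_half g blk \<xi> X \<mu> \<longleftrightarrow>
     (\<forall>\<alpha>\<in>dual_feasible blk \<xi>.
        dual g blk \<xi> X \<alpha> - dual_opt g blk \<xi> X
        \<le> (INF s\<in>subdifferential (dual g blk \<xi> X) \<alpha>. ereal ((norm s)\<^sup>2)) / ereal (2 * \<mu>))"


subsection \<open>The method\<close>

definition Qsub ::
  "(real ^ 'n \<Rightarrow> ereal) \<Rightarrow> ('k \<Rightarrow> 'l::finite) \<Rightarrow> ('l \<Rightarrow> real ^ 'k \<Rightarrow> real)
     \<Rightarrow> real ^ 'k ^ 'n \<Rightarrow> real ^ 'k ^ 'k \<Rightarrow> real ^ 'k \<Rightarrow> real ^ 'k \<Rightarrow> ereal" where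
  "Qsub g blk \<xi> X B \<alpha> d =
     ereal (grad_Gstar g X \<alpha> \<bullet> d + 1 / 2 * (d \<bullet> (B *v d))) + xi_conj blk \<xi> (- \<alpha> - d)"

definition Delta ::
  "(real ^ 'n \<Rightarrow> ereal) \<Rightarrow> ('k \<Rightarrow> 'l::finite) \<Rightarrow> ('l \<Rightarrow> real ^ 'k \<Rightarrow> real)
     \<Rightarrow> real ^ 'k ^ 'n \<Rightarrow> real ^ 'k \<Rightarrow> real ^ 'k \<Rightarrow> ereal" where
  "Delta g blk \<xi> X \<alpha> d =
     ereal (grad_Gstar g X \<alpha> \<bullet> d) + xi_conj blk \<xi> (- \<alpha> - d) - xi_conj blk \<xi> (- \<alpha>)"

definition armijo ::
  "(real ^ 'n \<Rightarrow> ereal) \<Rightarrow> ('k \<Rightarrow> 'l::finite) \<Rightarrow> ('l \<Rightarrow> real ^ 'k \<Rightarrow> real)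
     \<Rightarrow> real ^ 'k ^ 'n \<Rightarrow> real \<Rightarrow> real ^ 'k \<Rightarrow> real ^ 'k \<Rightarrow> real \<Rightarrow> bool" where
  "armijo g blk \<xi> X \<tau> \<alpha> d \<eta> \<longleftrightarrow>
     dual g blk \<xi> X (\<alpha> + \<eta> *\<^sub>R d)
     \<le> dual g blk \<xi> X \<alpha> + ereal (\<eta> * \<tau>) * Delta g blk \<xi> X \<alpha> d"

definition backtracking_step ::
  "(real ^ 'n \<Rightarrow> ereal) \<Rightarrow> ('k \<Rightarrow> 'l::finite) \<Rightarrow> ('l \<Rightarrow> real ^ 'k \<Rightarrow> real)
     \<Rightarrow> real ^ 'k ^ 'n \<Rightarrow> real \<Rightarrow> real \<Rightarrow> real ^ 'k \<Rightarrow> real ^ 'k \<Rightarrow> real" where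
  "backtracking_step g blk \<xi> X \<beta> \<tau> \<alpha> d = \<beta> ^ (LEAST i. armijo g blk \<xi> X \<tau> \<alpha> d (\<beta> ^ i))"

definition exact_step ::
  "(real ^ 'n \<Rightarrow> ereal) \<Rightarrow> ('k \<Rightarrow> 'l::finite) \<Rightarrow> ('l \<Rightarrow> real ^ 'k \<Rightarrow> real)
     \<Rightarrow> real ^ 'k ^ 'n \<Rightarrow> real ^ 'k \<Rightarrow> real ^ 'k \<Rightarrow> real \<Rightarrow> bool" where
  "exact_step g blk \<xi> X \<alpha> d \<eta> \<longleftrightarrow>
     is_arg_min (\<lambda>s. dual g blk \<xi> X (\<alpha> + s *\<^sub>R d)) (\<lambda>_. True) \<eta>"

end

theory Submission
  imports Defs
begin

text \<open>
  The model decrease \<open>\<Delta> = \<nabla>G\<^sup>*(\<alpha>) \<bullet> d + \<xi>\<^sup>*(-\<alpha> - d) - \<xi>\<^sup>*(-\<alpha>)\<close> is at most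
  \<open>-(C\<^sub>1 + C\<^sub>2) / 2 * \<parallel>d\<parallel>\<^sup>2\<close>, by strong convexity of the model at its minimizer \<open>d\<close>. The
  optimality condition of the model provides the subgradient \<open>\<nabla>G\<^sup>*(\<alpha> + d) - \<nabla>G\<^sup>*(\<alpha>) - B d\<close> of
  the dual objective at \<open>\<alpha> + d\<close>, of norm \<open>O(\<parallel>d\<parallel>)\<close>, so that the Kurdyka-Lojasiewicz inequality
  bounds the gap at the full step by a multiple of \<open>-\<Delta>\<close>. This bound is transported to the
  actual step by convexity along the segment and combined with the sufficient decrease condition.
  An exact line search does at least as well as the step that backtracking would choose.
\<close>

subsection \<open>Conjugates of strongly convex functions\<close>

text \<open>Limit as \<theta> tends to 0 from the right. It serves first-order conditions along a
  segment that have already been divided by \<theta>.\<close>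

lemma nonneg_if_affine_nonneg_near_zero:
  fixes a b :: real
  assumes "\<And>\<theta>. 0 < \<theta> \<Longrightarrow> \<theta> < 1 \<Longrightarrow> 0 \<le> a + \<theta> * b"
  shows "0 \<le> a"
proof (rule tendsto_lowerbound)
  show "((\<lambda>\<theta>. a + \<theta> * b) \<longlongrightarrow> a) (at_right 0)"
    by (auto intro!: tendsto_eq_intros)
  show "\<forall>\<^sub>F \<theta> in at_right 0. 0 \<le> a + \<theta> * b"
    using assms by (auto simp: eventually_at_right_field intro!: exI[of _ 1])
qed simp

section \<open>Attainment of minima of closed extended-real-valued functions\<close>

lemma closed_sublevel:
  fixes h :: "'a::metric_space \<Rightarrow> ereal"
  assumes "closed_fun h"
  shows "closed {x. h x \<le> ereal r}"
proof -
  have "closed ((\<lambda>x. (x, r)) -` epi h)"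
    using assms unfolding closed_fun_def
    by (intro closed_vimage continuous_intros) auto
  then show ?thesis by (simp add: epi_def vimage_def)
qed

text \<open>Weierstrass for lower semicontinuous functions. Without a minimizer each
  \<open>x\<close> has a level \<open>r x\<close> below \<open>h x\<close> that some point of
  \<open>S\<close> undercuts. The open sets where \<open>h\<close> exceeds these levels cover
  \<open>S\<close>, but a point undercutting the smallest level of a finite subcover lies in none of
  its sets.\<close>

lemma closed_fun_attains_inf:
  fixes h :: "'a::metric_space \<Rightarrow> ereal"
  assumes "closed_fun h" "compact S" "S \<noteq> {}"
  shows "\<exists>x\<in>S. \<forall>y\<in>S. h x \<le> h y"
proof (rule ccontr)
  assume "\<not> ?thesis"
  then have "\<forall>x\<in>S. \<exists>r. (\<exists>y\<in>S. h y < ereal r) \<and> ereal r < h x"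
    by (meson ereal_dense2 not_le)
  then obtain r where r: "\<And>x. x \<in> S \<Longrightarrow> (\<exists>y\<in>S. h y < ereal (r x)) \<and> ereal (r x) < h x"
    by metis
  have "open (- {z. h z \<le> ereal (r x)})" for x
    using closed_sublevel[OF assms(1)] by blast
  moreover have "S \<subseteq> (\<Union>x\<in>S. - {z. h z \<le> ereal (r x)})"
    using r by (fastforce simp: not_le)
  ultimately obtain F where F: "F \<subseteq> S" "finite F" "S \<subseteq> (\<Union>x\<in>F. - {z. h z \<le> ereal (r x)})"
    using compactE_image[OF assms(2), of S "\<lambda>x. - {z. h z \<le> ereal (r x)}"] by metis
  with assms(3) have "F \<noteq> {}" by auto
  then obtain x where x: "x \<in> F" "\<And>x'. x' \<in> F \<Longrightarrow> r x \<le> r x'"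
    using F(2) arg_min_if_finite(1)[of F r] arg_min_least[of F _ r] by blast
  then obtain y where y: "y \<in> S" "h y < ereal (r x)"
    using r F(1) by blast
  then obtain x' where "x' \<in> F" "ereal (r x') < h y"
    using subsetD[OF F(3) y(1)] by (auto simp: not_le)
  with x y show False
    by (meson ereal_less_eq(3) less_le_not_le order.trans order_less_imp_le)
qed

lemma strongly_convex_funD:
  assumes "strongly_convex_fun m h" "h x = ereal a" "h y = ereal b" "0 \<le> \<theta>" "\<theta> \<le> 1"
  shows "h ((1 - \<theta>) *\<^sub>R x + \<theta> *\<^sub>R y)
    \<le> ereal ((1 - \<theta>) * a + \<theta> * b - m / 2 * \<theta> * (1 - \<theta>) * (norm (x - y))\<^sup>2)"
proof -
  have "h ((1 - \<theta>) *\<^sub>R x + \<theta> *\<^sub>R y) + ereal (m / 2 * \<theta> * (1 - \<theta>) * (norm (x - y))\<^sup>2)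
      \<le> ereal (1 - \<theta>) * h x + ereal \<theta> * h y"
    using assms(1,4,5) unfolding strongly_convex_fun_def by simp
  then show ?thesis
    using assms(2,3) by (cases "h ((1 - \<theta>) *\<^sub>R x + \<theta> *\<^sub>R y)") auto
qed

text \<open>The minimizer is compared with a point at fraction \<theta> of the way to
  \<open>y\<close>; division by \<theta> and the limit \<theta> to 0 keep the full constant
  \<open>m / 2\<close>.\<close>

lemma strongly_convex_min_growth:
  assumes "strongly_convex_fun m h" and min: "\<And>y. h x \<le> h y" and hx: "h x = ereal a"
  shows "ereal (a + m / 2 * (norm (y - x))\<^sup>2) \<le> h y"
proof (cases "h y")
  case (real b)
  let ?c = "m / 2 * (norm (y - x))\<^sup>2"
  have "0 \<le> (b - a - ?c) + \<theta> * ?c" if "0 < \<theta>" "\<theta> < 1" for \<theta>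
  proof -
    have "h x \<le> ereal ((1 - \<theta>) * a + \<theta> * b - m / 2 * \<theta> * (1 - \<theta>) * (norm (x - y))\<^sup>2)"
      using that by (intro order_trans[OF min strongly_convex_funD[OF assms(1) hx real]]) auto
    with hx have "0 \<le> \<theta> * ((b - a - ?c) + \<theta> * ?c)"
      by (simp add: norm_minus_commute[of x y] field_simps)
    with that show ?thesis by (simp add: zero_le_mult_iff)
  qed
  from nonneg_if_affine_nonneg_near_zero[OF this] show ?thesis
    using real by simp
qed (use min[of y] hx in auto)

text \<open>No global lower bound is given. Compactness bounds \<open>h\<close> from below on a unit
  ball, and strong convexity turns this into coercivity, so that a minimizer over a larger ball is a
  global one.\<close>

lemma strongly_convex_closed_attains_min:
  fixes h :: "'a::euclidean_space \<Rightarrow> ereal"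
  assumes "m > 0" "strongly_convex_fun m h" "closed_fun h" "proper_fun h"
  obtains x a where "h x = ereal a" "\<And>y. h x \<le> h y"
proof -
  have fin: "h x \<noteq> -\<infinity>" for x
    using assms(4) by (auto simp: proper_fun_def)
  obtain x\<^sub>0 b where x\<^sub>0: "h x\<^sub>0 = ereal b"
    using assms(4) fin by (metis ereal_cases proper_fun_def)
  obtain z where z: "z \<in> cball x\<^sub>0 1" "\<And>y. y \<in> cball x\<^sub>0 1 \<Longrightarrow> h z \<le> h y"
    using closed_fun_attains_inf[OF assms(3) compact_cball, of x\<^sub>0 1] by auto
  have "h z \<le> ereal b" using z(2)[of x\<^sub>0] x\<^sub>0 by simp
  then obtain c where c: "h z = ereal c" "c \<le> b"
    using fin[of z] by (cases "h z") auto
  \<comment> \<open>Chosen so that \<open>m / 2 * (R - 1) = b - c\<close>: beyond this radius the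
    strong convexity term compensates the drop from \<open>b\<close> to \<open>c\<close>.\<close>
  define R where "R = 1 + 2 * (b - c) / m"
  have R: "R \<ge> 1" using c(2) assms(1) by (simp add: R_def)
  have out: "ereal b \<le> h y" if y: "y \<notin> cball x\<^sub>0 R" for y
  proof (cases "h y")
    case (real e)
    define s where "s = norm (x\<^sub>0 - y)"
    have s: "s > R" using y by (simp add: s_def dist_norm)
    \<comment> \<open>This weight puts the convex combination at distance exactly 1 from
      \<open>x\<^sub>0\<close>, where \<open>h\<close> is at least \<open>c\<close>.\<close>
    define \<theta> where "\<theta> = 1 / s"
    have \<theta>: "0 \<le> \<theta>" "\<theta> \<le> 1" "\<theta> * s = 1" using s R by (auto simp: \<theta>_def)
    have "x\<^sub>0 - ((1 - \<theta>) *\<^sub>R x\<^sub>0 + \<theta> *\<^sub>R y) = \<theta> *\<^sub>R (x\<^sub>0 - y)" by (simp add: algebra_simps)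
    then have "(1 - \<theta>) *\<^sub>R x\<^sub>0 + \<theta> *\<^sub>R y \<in> cball x\<^sub>0 1"
      using \<theta> by (simp add: dist_norm s_def)
    then have "ereal c \<le> h ((1 - \<theta>) *\<^sub>R x\<^sub>0 + \<theta> *\<^sub>R y)"
      using z(2) c by metis
    also have "\<dots> \<le> ereal ((1 - \<theta>) * b + \<theta> * e - m / 2 * \<theta> * (1 - \<theta>) * s\<^sup>2)"
      unfolding s_def by (rule strongly_convex_funD[OF assms(2) x\<^sub>0 real \<theta>(1,2)])
    finally have 1: "c \<le> (1 - \<theta>) * b + \<theta> * e - m / 2 * \<theta> * (1 - \<theta>) * s\<^sup>2"
      by simp
    have "m / 2 * \<theta> * (1 - \<theta>) * s\<^sup>2 = m / 2 * (\<theta> * s) * (s - \<theta> * s)"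
      by (simp add: power2_eq_square algebra_simps)
    also have "\<dots> = m / 2 * (s - 1)" using \<theta>(3) by simp
    finally have "c \<le> (1 - \<theta>) * b + \<theta> * e - m / 2 * (s - 1)" using 1 by linarith
    moreover have "m / 2 * (s - 1) \<ge> b - c"
    proof -
      have "2 * (b - c) / m \<le> s - 1" using s by (simp add: R_def)
      then show ?thesis using assms(1) by (simp add: field_simps)
    qed
    moreover have "(1 - \<theta>) * b + \<theta> * e = b + \<theta> * (e - b)" by (simp add: algebra_simps)
    ultimately have "0 \<le> \<theta> * (e - b)" by linarith
    moreover have "\<theta> > 0" using s R by (simp add: \<theta>_def)
    ultimately show ?thesis using real by (simp add: zero_le_mult_iff)
  qed (use fin in auto)
  obtain x where x: "x \<in> cball x\<^sub>0 R" "\<And>y. y \<in> cball x\<^sub>0 R \<Longrightarrow> h x \<le> h y"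
    using closed_fun_attains_inf[OF assms(3) compact_cball, of x\<^sub>0 R] R by auto
  have "h x \<le> ereal b" using x(2)[of x\<^sub>0] R x\<^sub>0 by simp
  then have "h x \<le> h y" for y using out x(2) order_trans by blast
  moreover obtain a where "h x = ereal a"
    using \<open>h x \<le> ereal b\<close> fin[of x] by (cases "h x") auto
  ultimately show thesis using that by blast
qed

text \<open>The new epigraph is the preimage of the old one under a continuous shear.\<close>

lemma closed_fun_add_continuous:
  fixes h :: "'a::metric_space \<Rightarrow> ereal"
  assumes "closed_fun h" "continuous_on UNIV \<phi>"
  shows "closed_fun (\<lambda>x. h x + ereal (\<phi> x))"
proof -
  have *: "h x + ereal p \<le> ereal r \<longleftrightarrow> h x \<le> ereal (r - p)" for x p r
    by (cases "h x") auto
  have "continuous_on UNIV (\<phi> \<circ> fst)"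
    by (intro continuous_on_compose continuous_on_fst continuous_on_id continuous_on_subset[OF assms(2)]) auto
  then have "closed ((\<lambda>p. (fst p, snd p - \<phi> (fst p))) -` epi h)"
    using assms(1) unfolding closed_fun_def
    by (intro closed_vimage continuous_intros) (auto simp: o_def)
  moreover have "(\<lambda>p. (fst p, snd p - \<phi> (fst p))) -` epi h = epi (\<lambda>x. h x + ereal (\<phi> x))"
    by (auto simp: epi_def *)
  ultimately show ?thesis by (simp add: closed_fun_def)
qed

lemma strongly_convex_fun_tilt:
  fixes h :: "'a::real_inner \<Rightarrow> ereal"
  assumes "strongly_convex_fun m h"
  shows "strongly_convex_fun m (\<lambda>x. h x + ereal (x \<bullet> u))"
  unfolding strongly_convex_fun_def
proof (intro allI ballI)
  fix x y :: 'a and \<theta> :: real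
  assume \<theta>: "\<theta> \<in> {0..1}"
  let ?z = "(1 - \<theta>) *\<^sub>R x + \<theta> *\<^sub>R y" and ?e = "m / 2 * \<theta> * (1 - \<theta>) * (norm (x - y))\<^sup>2"
  \<comment> \<open>Distributivity is safe in \<open>ereal\<close> here because the second summand
    is finite.\<close>
  have scale: "ereal c * (k + ereal e) = ereal c * k + ereal (c * e)" if "0 \<le> c" for c k e
    using that by (cases k) (auto simp: distrib_left)
  have "h ?z + ereal ?e \<le> ereal (1 - \<theta>) * h x + ereal \<theta> * h y"
    using assms \<theta> by (simp add: strongly_convex_fun_def)
  then have "h ?z + ereal ?e + ereal (?z \<bullet> u)
      \<le> ereal (1 - \<theta>) * h x + ereal \<theta> * h y + ereal (?z \<bullet> u)"
    by (rule add_right_mono)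
  also have "ereal (?z \<bullet> u) = ereal ((1 - \<theta>) * (x \<bullet> u)) + ereal (\<theta> * (y \<bullet> u))"
    by (simp add: inner_add_left)
  finally show "h ?z + ereal (?z \<bullet> u) + ereal ?e
      \<le> ereal (1 - \<theta>) * (h x + ereal (x \<bullet> u)) + ereal \<theta> * (h y + ereal (y \<bullet> u))"
    using \<theta> by (simp add: scale inner_add_left add_ac flip: plus_ereal.simps(1))
qed

lemma conj_on_ge:
  assumes "z \<in> S" "h z = ereal r"
  shows "ereal (z \<bullet> u - r) \<le> conj_on S h u"
  unfolding conj_on_def using assms
  by (intro SUP_upper2[of z]) (auto simp: effdom_def)

text \<open>The minimizer \<open>w u\<close> of the tilted function
  \<open>g x - x \<bullet> u\<close> attains the supremum defining the conjugate at
  \<open>u\<close>, and is its gradient there. Testing with \<open>w u\<close> gives the lower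
  bound; quadratic growth around \<open>w u\<close> gives the other two. Differentiability is
  expressed through these bounds alone.\<close>

lemma strongly_convex_conjugate:
  fixes g :: "'a::euclidean_space \<Rightarrow> ereal"
  assumes \<sigma>: "\<sigma> > 0" and "strongly_convex_fun \<sigma> g" "closed_fun g" "proper_fun g"
  obtains G and w :: "'a \<Rightarrow> 'a" where "\<And>u. conjugate g u = ereal (G u)"
    and "\<And>u v. G u + w u \<bullet> (v - u) \<le> G v"
    and "\<And>u v. G v \<le> G u + w u \<bullet> (v - u) + (norm (v - u))\<^sup>2 / (2 * \<sigma>)"
    and "\<And>u v. norm (w u - w v) \<le> norm (u - v) / \<sigma>"
proof -
  have fin: "g x \<noteq> -\<infinity>" for x
    using assms(4) by (auto simp: proper_fun_def)
  let ?h = "\<lambda>u x. g x + ereal (x \<bullet> (- u))"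
  have sc: "strongly_convex_fun \<sigma> (?h u)" for u
    by (rule strongly_convex_fun_tilt[OF assms(2)])
  have "\<exists>x a. ?h u x = ereal a \<and> (\<forall>y. ?h u x \<le> ?h u y)" for u
  proof -
    have "closed_fun (?h u)"
      by (intro closed_fun_add_continuous assms(3) continuous_intros)
    moreover have "proper_fun (?h u)"
      using assms(4) by (auto simp: proper_fun_def)
    ultimately obtain x a where "?h u x = ereal a" "\<And>y. ?h u x \<le> ?h u y"
      using strongly_convex_closed_attains_min[OF \<sigma> sc, of u] by blast
    then show ?thesis by blast
  qed
  then have "\<forall>u. \<exists>p. ?h u (fst p) = ereal (snd p) \<and> (\<forall>y. ?h u (fst p) \<le> ?h u y)"
    by (metis fst_conv snd_conv)
  then obtain p where p: "\<And>u. ?h u (fst (p u)) = ereal (snd (p u)) \<and> (\<forall>y. ?h u (fst (p u)) \<le> ?h u y)"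
    by (rule choice[THEN exE]) blast
  define w where "w u = fst (p u)" for u
  define a where "a u = snd (p u)" for u
  have w: "?h u (w u) = ereal (a u)" "?h u (w u) \<le> ?h u y" for u y
    using p[of u] by (auto simp: w_def a_def)
  have gw: "g (w u) = ereal (a u + w u \<bullet> u)" for u
    using w(1)[of u] by (cases "g (w u)") auto
  have growth: "ereal (a u + y \<bullet> u + \<sigma> / 2 * (norm (y - w u))\<^sup>2) \<le> g y" for u y
    using strongly_convex_min_growth[OF sc w(2) w(1), of u y]
    by (cases "g y") auto
  have lower: "ereal (- a u + w u \<bullet> (v - u)) \<le> conjugate g v" for u v
    using conj_on_ge[of "w u" UNIV g, OF _ gw, of v] by (simp add: inner_diff_right algebra_simps)
  \<comment> \<open>The slack in Young's inequality for \<open>p \<bullet> q\<close>, used with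
    \<open>p = y - w u\<close> and \<open>q = v - u\<close>.\<close>
  have square: "(norm (\<sigma> *\<^sub>R p - q))\<^sup>2 / (2 * \<sigma>)
      = \<sigma> / 2 * (norm p)\<^sup>2 - p \<bullet> q + (norm q)\<^sup>2 / (2 * \<sigma>)" for p q :: 'a
    using \<sigma> unfolding power2_norm_eq_inner
    by (simp add: inner_diff_left inner_diff_right inner_commute[of q p] field_simps)
  have upper: "conjugate g v \<le> ereal (- a u + w u \<bullet> (v - u) + (norm (v - u))\<^sup>2 / (2 * \<sigma>))" for u v
    unfolding conj_on_def
  proof (rule SUP_least)
    fix y assume "y \<in> UNIV \<inter> effdom g"
    then obtain b where b: "g y = ereal b"
      using fin[of y] by (cases "g y") (auto simp: effdom_def)
    have 1: "a u + y \<bullet> u + \<sigma> / 2 * (norm (y - w u))\<^sup>2 \<le> b"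
      using growth[of u y] b by simp
    have "0 \<le> (norm (\<sigma> *\<^sub>R (y - w u) - (v - u)))\<^sup>2 / (2 * \<sigma>)"
      using \<sigma> by simp
    also have "\<dots> = \<sigma> / 2 * (norm (y - w u))\<^sup>2 - (y - w u) \<bullet> (v - u) + (norm (v - u))\<^sup>2 / (2 * \<sigma>)"
      by (rule square)
    finally show "ereal (y \<bullet> v) - g y
        \<le> ereal (- a u + w u \<bullet> (v - u) + (norm (v - u))\<^sup>2 / (2 * \<sigma>))"
      using 1 b by (simp add: inner_diff_left inner_diff_right)
  qed
  have eq: "conjugate g u = ereal (- a u)" for u
    using lower[of u u] upper[of u u] by (simp add: antisym)
  have lip: "norm (w u - w v) \<le> norm (u - v) / \<sigma>" for u v
  proof -
    \<comment> \<open>Growth around each minimizer, tested at the other one; in the sum the optimal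
      values cancel.\<close>
    have "a u + w v \<bullet> u + \<sigma> / 2 * (norm (w v - w u))\<^sup>2 \<le> a v + w v \<bullet> v"
      "a v + w u \<bullet> v + \<sigma> / 2 * (norm (w u - w v))\<^sup>2 \<le> a u + w u \<bullet> u"
      using growth[of u "w v"] growth[of v "w u"] gw by auto
    then have "\<sigma> * (norm (w u - w v))\<^sup>2 \<le> (w u - w v) \<bullet> (u - v)"
      by (simp add: inner_diff_left inner_diff_right norm_minus_commute)
    also have "\<dots> \<le> norm (w u - w v) * norm (u - v)"
      by (rule norm_cauchy_schwarz)
    finally have "norm (w u - w v) * (\<sigma> * norm (w u - w v)) \<le> norm (w u - w v) * norm (u - v)"
      by (simp add: power2_eq_square algebra_simps)
    then have "\<sigma> * norm (w u - w v) \<le> norm (u - v)"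
      using \<sigma> by (cases "norm (w u - w v) = 0") (auto simp: mult_le_cancel_left)
    then show ?thesis using \<sigma> by (simp add: field_simps)
  qed
  show thesis
    by (rule that[of "\<lambda>u. - a u" w]) (use eq lower upper lip in auto)
qed

subsection \<open>One step on the sum of a smooth and a convex function\<close>

text \<open>\<gamma> is not declared to be a gradient: the affine lower bound and the quadratic
  upper bound force it to be the gradient of \<open>G\<close>, and the lower bound also makes
  \<open>G\<close> convex.\<close>

definition smooth_plus_convex ::
  "('a::euclidean_space \<Rightarrow> real) \<Rightarrow> ('a \<Rightarrow> 'a) \<Rightarrow> real \<Rightarrow> ('a \<Rightarrow> ereal) \<Rightarrow> bool" where
  "smooth_plus_convex G \<gamma> K P \<longleftrightarrow>
     (\<forall>x y. G x + \<gamma> x \<bullet> (y - x) \<le> G y) \<and>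
     (\<forall>x y. G y \<le> G x + \<gamma> x \<bullet> (y - x) + K / 2 * (norm (y - x))\<^sup>2) \<and>
     (\<forall>x y. norm (\<gamma> x - \<gamma> y) \<le> K * norm (x - y)) \<and>
     0 \<le> K \<and> convex_fun P \<and> (\<forall>x. P x \<noteq> -\<infinity>)"

definition composite :: "('a \<Rightarrow> real) \<Rightarrow> ('a \<Rightarrow> ereal) \<Rightarrow> 'a \<Rightarrow> ereal" where
  "composite G P x = ereal (G x) + P x"

text \<open>The second-order model of the objective as a function of the displacement
  \<open>y\<close>, without the constant \<open>G x\<close>. \<open>Qsub\<close> is the instance
  where \<open>H\<close> multiplies by \<open>B\<close> and \<open>P\<close> is the reflected
  conjugate of \<xi>.\<close>

definition model ::
  "('a::real_inner \<Rightarrow> 'a) \<Rightarrow> ('a \<Rightarrow> ereal) \<Rightarrow> ('a \<Rightarrow> 'a) \<Rightarrow> 'a \<Rightarrow> 'a \<Rightarrow> ereal" where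
  "model \<gamma> P H x y = ereal (\<gamma> x \<bullet> y + 1 / 2 * (y \<bullet> H y)) + P (x + y)"

context
  fixes G :: "'a::euclidean_space \<Rightarrow> real" and \<gamma> :: "'a \<Rightarrow> 'a" and K :: real
    and P :: "'a \<Rightarrow> ereal"
  assumes composite: "smooth_plus_convex G \<gamma> K P"
begin

lemma
  shows G_lower: "G x + \<gamma> x \<bullet> (y - x) \<le> G y"
    and G_upper: "G y \<le> G x + \<gamma> x \<bullet> (y - x) + K / 2 * (norm (y - x))\<^sup>2"
    and \<gamma>_lipschitz: "norm (\<gamma> x - \<gamma> y) \<le> K * norm (x - y)"
    and K_nonneg: "0 \<le> K"
    and P_convex: "convex_fun P"
    and P_not_MInf: "P x \<noteq> -\<infinity>"
  using composite unfolding smooth_plus_convex_def by blast+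

section \<open>The objective along a segment and the minimizer of the model\<close>

lemma P_segment:
  assumes "P x = ereal p" "P (x + d) = ereal q" "0 \<le> \<eta>" "\<eta> \<le> 1"
  shows "P (x + \<eta> *\<^sub>R d) \<le> ereal ((1 - \<eta>) * p + \<eta> * q)"
proof -
  have "(1 - \<eta>) *\<^sub>R (x, p) + \<eta> *\<^sub>R (x + d, q) \<in> epi P"
    using P_convex assms unfolding convex_fun_def
    by (intro convexD) (auto simp: epi_def)
  then show ?thesis
    by (simp add: epi_def algebra_simps)
qed

text \<open>The linearization error lies between 0 and
  \<open>K / 2 * (norm (y - x))\<^sup>2\<close>, hence is \<open>o(norm (y - x))\<close>. Uniqueness
  of the derivative evaluates the definite description in \<open>gradient\<close>.\<close>

lemma gradient_G: "gradient G x = \<gamma> x"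
proof -
  have "GDERIV G x :> \<gamma> x"
    unfolding gderiv_def has_derivative_at2
  proof (intro conjI)
    show "bounded_linear (\<lambda>h. h \<bullet> \<gamma> x)" by (rule bounded_linear_inner_left)
    show "((\<lambda>y. (1 / norm (y - x)) *\<^sub>R (G y - (G x + (y - x) \<bullet> \<gamma> x))) \<longlongrightarrow> 0) (at x)"
    proof (rule Lim_null_comparison)
      show "\<forall>\<^sub>F y in at x. norm ((1 / norm (y - x)) *\<^sub>R (G y - (G x + (y - x) \<bullet> \<gamma> x)))
          \<le> K / 2 * norm (y - x)"
      proof (intro always_eventually allI)
        fix y
        have "\<bar>G y - (G x + (y - x) \<bullet> \<gamma> x)\<bar> \<le> K / 2 * (norm (y - x))\<^sup>2"
          using G_lower[of x y] G_upper[of y x] by (simp add: inner_commute)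
        then show "norm ((1 / norm (y - x)) *\<^sub>R (G y - (G x + (y - x) \<bullet> \<gamma> x)))
            \<le> K / 2 * norm (y - x)"
          using K_nonneg by (cases "y = x") (auto simp: divide_simps power2_eq_square mult_ac)
      qed
      show "((\<lambda>y. K / 2 * norm (y - x)) \<longlongrightarrow> 0) (at x)"
        by (auto intro!: tendsto_eq_intros)
    qed
  qed
  moreover have "D = \<gamma> x" if "GDERIV G x :> D" for D
    using has_derivative_unique[OF that[unfolded gderiv_def] calculation[unfolded gderiv_def]]
    by (metis inner_commute vector_eq_rdot)
  ultimately show ?thesis unfolding gradient_def by blast
qed

text \<open>The first bound, with the linearized decrease, serves the line search; the second, plain
  convexity, carries the gap at the full step to a shorter step.\<close>

lemma composite_segment:
  assumes "P x = ereal p" "P (x + d) = ereal q" "0 \<le> \<eta>" "\<eta> \<le> 1"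
  shows "composite G P (x + \<eta> *\<^sub>R d)
      \<le> ereal (G x + p + \<eta> * (\<gamma> x \<bullet> d + q - p) + K / 2 * \<eta>\<^sup>2 * (norm d)\<^sup>2)"
    and "composite G P (x + \<eta> *\<^sub>R d) \<le> ereal ((1 - \<eta>) * (G x + p) + \<eta> * (G (x + d) + q))"
proof -
  let ?z = "x + \<eta> *\<^sub>R d"
  obtain r where r: "P ?z = ereal r" "r \<le> (1 - \<eta>) * p + \<eta> * q"
    using P_segment[OF assms] P_not_MInf[of ?z] by (cases "P ?z") auto
  have "G ?z \<le> G x + \<eta> * (\<gamma> x \<bullet> d) + K / 2 * \<eta>\<^sup>2 * (norm d)\<^sup>2"
    using G_upper[of ?z x] by (simp add: power_mult_distrib)
  then show "composite G P ?z \<le> ereal (G x + p + \<eta> * (\<gamma> x \<bullet> d + q - p) + K / 2 * \<eta>\<^sup>2 * (norm d)\<^sup>2)"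
    using r by (simp add: composite_def algebra_simps)
  \<comment> \<open>The tangent plane at the intermediate point is evaluated at both ends; in the
    weighted sum its slope cancels.\<close>
  have "x - ?z = - (\<eta> *\<^sub>R d)" "x + d - ?z = (1 - \<eta>) *\<^sub>R d"
    by (simp_all add: algebra_simps)
  then have "G ?z - \<eta> * (\<gamma> ?z \<bullet> d) \<le> G x" "G ?z + (1 - \<eta>) * (\<gamma> ?z \<bullet> d) \<le> G (x + d)"
    using G_lower[of ?z x] G_lower[of ?z "x + d"] by simp_all
  then have "(1 - \<eta>) * (G ?z - \<eta> * (\<gamma> ?z \<bullet> d)) + \<eta> * (G ?z + (1 - \<eta>) * (\<gamma> ?z \<bullet> d))
      \<le> (1 - \<eta>) * G x + \<eta> * G (x + d)"
    using assms(3,4) by (intro add_mono mult_left_mono) auto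
  moreover have "(1 - \<eta>) * (G ?z - \<eta> * (\<gamma> ?z \<bullet> d)) + \<eta> * (G ?z + (1 - \<eta>) * (\<gamma> ?z \<bullet> d)) = G ?z"
    by (simp add: algebra_simps)
  ultimately show "composite G P ?z \<le> ereal ((1 - \<eta>) * (G x + p) + \<eta> * (G (x + d) + q))"
    using r by (simp add: composite_def algebra_simps)
qed

text \<open>Optimality of \<open>d\<close> makes \<open>- \<gamma> x - H d\<close> a subgradient of
  \<open>P\<close> at \<open>x + d\<close>; adding the gradient of \<open>G\<close> there gives the
  claim. The condition is derived by perturbing \<open>d\<close>, without a sum rule for
  subdifferentials.\<close>

lemma subgradient_at_model_min:
  assumes "linear H" and sym: "\<And>y z. y \<bullet> H z = H y \<bullet> z"
    and min: "\<And>y. model \<gamma> P H x d \<le> model \<gamma> P H x y"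
    and q: "P (x + d) = ereal q"
  shows "\<gamma> (x + d) - \<gamma> x - H d \<in> subdifferential (composite G P) (x + d)"
  unfolding subdifferential_def
proof (intro CollectI allI)
  fix y
  define e where "e = y - (x + d)"
  have y: "y = x + d + e" by (simp add: e_def)
  have "composite G P (x + d) + ereal ((\<gamma> (x + d) - \<gamma> x - H d) \<bullet> e) \<le> composite G P y"
  proof (cases "P y")
    case (real r)
    \<comment> \<open>Optimality against \<open>d + \<theta> *\<^sub>R e\<close>, divided by
      \<theta>. The curvature of \<open>H\<close> survives only with a factor \<theta>, so its sign
      does not matter in the limit.\<close>
    have "0 \<le> ((\<gamma> x + H d) \<bullet> e + r - q) + \<theta> * (e \<bullet> H e / 2)" if \<theta>: "0 < \<theta>" "\<theta> < 1" for \<theta>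
    proof -
      have "P (x + (d + \<theta> *\<^sub>R e)) \<le> ereal ((1 - \<theta>) * q + \<theta> * r)"
        using P_segment[of "x + d" q e r \<theta>] q real \<theta> by (simp add: y add.assoc)
      then have "model \<gamma> P H x (d + \<theta> *\<^sub>R e) \<le> ereal (\<gamma> x \<bullet> (d + \<theta> *\<^sub>R e)
          + 1 / 2 * ((d + \<theta> *\<^sub>R e) \<bullet> H (d + \<theta> *\<^sub>R e))) + ereal ((1 - \<theta>) * q + \<theta> * r)"
        unfolding model_def by (rule add_left_mono)
      with min[of "d + \<theta> *\<^sub>R e"] have "model \<gamma> P H x d \<le> ereal (\<gamma> x \<bullet> (d + \<theta> *\<^sub>R e)
          + 1 / 2 * ((d + \<theta> *\<^sub>R e) \<bullet> H (d + \<theta> *\<^sub>R e))) + ereal ((1 - \<theta>) * q + \<theta> * r)"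
        by (rule order_trans)
      then have "\<gamma> x \<bullet> d + 1 / 2 * (d \<bullet> H d) + q \<le> \<gamma> x \<bullet> (d + \<theta> *\<^sub>R e)
          + 1 / 2 * ((d + \<theta> *\<^sub>R e) \<bullet> H (d + \<theta> *\<^sub>R e)) + ((1 - \<theta>) * q + \<theta> * r)"
        unfolding model_def q by simp
      moreover have "(d + \<theta> *\<^sub>R e) \<bullet> H (d + \<theta> *\<^sub>R e)
          = d \<bullet> H d + 2 * \<theta> * (H d \<bullet> e) + \<theta> * (\<theta> * (e \<bullet> H e))"
        unfolding linear_add[OF assms(1)] linear_scale[OF assms(1)] inner_add_left inner_add_right
          inner_scaleR_left inner_scaleR_right sym[of d e] inner_commute[of e "H d"]
        by (simp add: algebra_simps)
      moreover have "\<gamma> x \<bullet> (d + \<theta> *\<^sub>R e) = \<gamma> x \<bullet> d + \<theta> * (\<gamma> x \<bullet> e)"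
        by (simp add: inner_add_right)
      ultimately have "0 \<le> \<theta> * (\<gamma> x \<bullet> e) + \<theta> * (H d \<bullet> e) + \<theta> * (\<theta> * (e \<bullet> H e)) / 2
          + ((1 - \<theta>) * q + \<theta> * r) - q"
        by (simp add: add_divide_distrib)
      also have "\<dots> = \<theta> * (((\<gamma> x + H d) \<bullet> e + r - q) + \<theta> * (e \<bullet> H e / 2))"
        by (simp add: inner_add_left algebra_simps)
      finally show ?thesis using \<theta> by (simp add: zero_le_mult_iff)
    qed
    from nonneg_if_affine_nonneg_near_zero[OF this]
    have "q \<le> (\<gamma> x + H d) \<bullet> e + r" by simp
    moreover have "G (x + d) + \<gamma> (x + d) \<bullet> e \<le> G y"
      unfolding e_def by (rule G_lower)
    ultimately show ?thesis
      by (simp add: composite_def q real inner_add_left inner_diff_left)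
  qed (use P_not_MInf in \<open>auto simp: composite_def\<close>)
  then show "composite G P (x + d) + ereal ((\<gamma> (x + d) - \<gamma> x - H d) \<bullet> (y - (x + d))) \<le> composite G P y"
    by (simp only: e_def)
qed

text \<open>The model at displacement 0 is just \<open>p\<close>. Strong convexity contributes
  \<open>C\<^sub>2\<close> and the quadratic term of the model contributes \<open>C\<^sub>1\<close>,
  so \<open>H\<close> may be indefinite.\<close>

lemma model_min_decrease:
  assumes p: "P x = ereal p"
    and growth: "model \<gamma> P H x d + ereal (C\<^sub>2 / 2 * (norm d)\<^sup>2) \<le> model \<gamma> P H x 0"
    and eig: "C\<^sub>1 * (norm d)\<^sup>2 \<le> d \<bullet> H d"
  obtains q where "P (x + d) = ereal q" "\<gamma> x \<bullet> d + q - p \<le> - ((C\<^sub>1 + C\<^sub>2) / 2 * (norm d)\<^sup>2)"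
proof -
  obtain q where q: "P (x + d) = ereal q"
    using growth P_not_MInf[of "x + d"] p by (cases "P (x + d)") (auto simp: model_def)
  have "\<gamma> x \<bullet> d + q - p \<le> - (d \<bullet> H d) / 2 - C\<^sub>2 / 2 * (norm d)\<^sup>2"
    using growth by (simp add: model_def p q)
  also have "\<dots> \<le> - ((C\<^sub>1 + C\<^sub>2) / 2 * (norm d)\<^sup>2)"
    using eig by (simp add: field_simps)
  finally show thesis using that q by blast
qed

text \<open>The subgradient at \<open>x + d\<close> has norm at most
  \<open>(K + C\<^sub>3) * norm d\<close>. The Kurdyka-Lojasiewicz inequality bounds the gap by its
  square, and the predicted decrease controls \<open>(norm d)\<^sup>2\<close>.\<close>

lemma gap_at_model_min:
  assumes H: "linear H" "\<And>y z. y \<bullet> H z = H y \<bullet> z"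
    and min: "\<And>y. model \<gamma> P H x d \<le> model \<gamma> P H x y"
    and q: "P (x + d) = ereal q"
    and \<Delta>: "\<gamma> x \<bullet> d + q - p \<le> - (C / 2 * (norm d)\<^sup>2)"
    and bound: "norm (H d) \<le> C\<^sub>3 * norm d"
    and "C > 0" "\<mu> > 0"
    and KL: "\<And>s. s \<in> subdifferential (composite G P) (x + d) \<Longrightarrow>
      composite G P (x + d) \<le> ereal (F + (norm s)\<^sup>2 / (2 * \<mu>))"
  shows "\<mu> * C * (G (x + d) + q - F) \<le> - (2 * (K\<^sup>2 + C\<^sub>3\<^sup>2) * (\<gamma> x \<bullet> d + q - p))"
proof -
  define s where "s = \<gamma> (x + d) - \<gamma> x - H d"
  define n where "n = norm d"
  have "norm s \<le> norm (\<gamma> (x + d) - \<gamma> x) + norm (H d)"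
    unfolding s_def by (rule norm_triangle_ineq4)
  also have "\<dots> \<le> K * n + C\<^sub>3 * n"
    using \<gamma>_lipschitz[of "x + d" x] bound by (intro add_mono) (auto simp: n_def)
  finally have "(norm s)\<^sup>2 \<le> (K * n + C\<^sub>3 * n)\<^sup>2"
    by (intro power_mono) auto
  also have "\<dots> = 2 * (K\<^sup>2 + C\<^sub>3\<^sup>2) * n\<^sup>2 - (K * n - C\<^sub>3 * n)\<^sup>2"
    by (simp add: power2_eq_square algebra_simps)
  also have "\<dots> \<le> 2 * (K\<^sup>2 + C\<^sub>3\<^sup>2) * n\<^sup>2" by simp
  finally have s: "(norm s)\<^sup>2 \<le> 2 * (K\<^sup>2 + C\<^sub>3\<^sup>2) * n\<^sup>2" .
  have "s \<in> subdifferential (composite G P) (x + d)"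
    unfolding s_def by (rule subgradient_at_model_min[OF H min q])
  then have "G (x + d) + q - F \<le> (norm s)\<^sup>2 / (2 * \<mu>)"
    using KL[of s] by (simp add: composite_def q)
  then have "\<mu> * (G (x + d) + q - F) \<le> (norm s)\<^sup>2 / 2"
    using \<open>\<mu> > 0\<close> by (simp add: field_simps)
  also have "\<dots> \<le> (K\<^sup>2 + C\<^sub>3\<^sup>2) * n\<^sup>2" using s by linarith
  finally have "C * (\<mu> * (G (x + d) + q - F)) \<le> C * ((K\<^sup>2 + C\<^sub>3\<^sup>2) * n\<^sup>2)"
    using \<open>C > 0\<close> by (simp add: mult_left_mono)
  \<comment> \<open>The factor 2 in the denominator of the rate comes from this
    \<open>C / 2\<close>; the 2 from squaring a sum has cancelled against the one in
    \<open>2 * \<mu>\<close>.\<close>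
  also have "\<dots> = 2 * (K\<^sup>2 + C\<^sub>3\<^sup>2) * (C / 2 * n\<^sup>2)" by simp
  also have "\<dots> \<le> 2 * (K\<^sup>2 + C\<^sub>3\<^sup>2) * (- (\<gamma> x \<bullet> d + q - p))"
    using \<Delta> by (intro mult_left_mono) (auto simp: n_def)
  finally show ?thesis
    unfolding mult_minus_right mult.assoc[of \<mu> C] mult.left_commute[of \<mu> C] .
qed

text \<open>Convexity along the segment (weighted by \<open>a * \<tau>\<close>) and sufficient decrease (weighted by
  \<open>S\<close>) are added so that the predicted decrease \<open>\<gamma> x \<bullet> d + q - p\<close> cancels; using convexity
  of \<open>G\<close> in place of the latter would lose the factor \<open>\<tau>\<close> in the denominator.\<close>

lemma sufficient_decrease_contraction:
  assumes p: "P x = ereal p" and q: "P (x + d) = ereal q"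
    and \<eta>: "0 \<le> \<eta>" "\<eta> \<le> 1"
    and gap: "a * (G (x + d) + q - F) \<le> - (S * (\<gamma> x \<bullet> d + q - p))"
    and pos: "a > 0" "S > 0" "\<tau> > 0"
    and decrease: "composite G P (x + \<eta> *\<^sub>R d) \<le> ereal (G x + p + \<eta> * \<tau> * (\<gamma> x \<bullet> d + q - p))"
  shows "composite G P (x + \<eta> *\<^sub>R d) \<le> ereal (F + (1 - a * \<tau> / (a * \<tau> + S) * \<eta>) * (G x + p - F))"
proof -
  define \<Delta> where "\<Delta> = \<gamma> x \<bullet> d + q - p"
  define \<delta> where "\<delta> = G x + p - F"
  define \<delta>\<^sub>1 where "\<delta>\<^sub>1 = G (x + d) + q - F"
  obtain v where v: "composite G P (x + \<eta> *\<^sub>R d) = ereal (F + v)"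
  proof -
    have "composite G P (x + \<eta> *\<^sub>R d) \<noteq> -\<infinity>" using P_not_MInf by (simp add: composite_def)
    then obtain r where "composite G P (x + \<eta> *\<^sub>R d) = ereal r"
      using decrease by (cases "composite G P (x + \<eta> *\<^sub>R d)") auto
    then show thesis using that[of "r - F"] by simp
  qed
  have "F + v \<le> (1 - \<eta>) * (F + \<delta>) + \<eta> * (F + \<delta>\<^sub>1)"
    using composite_segment(2)[OF p q \<eta>] by (simp add: v \<delta>_def \<delta>\<^sub>1_def)
  then have 1: "v \<le> (1 - \<eta>) * \<delta> + \<eta> * \<delta>\<^sub>1" by (simp add: algebra_simps)
  have 2: "v \<le> \<delta> + \<eta> * \<tau> * \<Delta>"
    using decrease by (simp add: v \<delta>_def \<Delta>_def)
  have "(a * \<tau> + S) * v \<le> a * \<tau> * ((1 - \<eta>) * \<delta> + \<eta> * \<delta>\<^sub>1) + S * (\<delta> + \<eta> * \<tau> * \<Delta>)"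
    unfolding distrib_right[of "a * \<tau>"] using 1 2 pos by (intro add_mono mult_left_mono) auto
  \<comment> \<open>The last bracket is nonpositive by \<open>gap\<close>.\<close>
  also have "\<dots> = a * \<tau> * (1 - \<eta>) * \<delta> + S * \<delta> + \<eta> * \<tau> * (a * \<delta>\<^sub>1 + S * \<Delta>)"
    by (simp add: algebra_simps)
  also have "\<dots> \<le> a * \<tau> * (1 - \<eta>) * \<delta> + S * \<delta>"
    using gap \<eta> pos by (simp add: \<Delta>_def \<delta>\<^sub>1_def mult_nonneg_nonpos)
  also have "\<dots> = (a * \<tau> + S) * ((1 - a * \<tau> / (a * \<tau> + S) * \<eta>) * \<delta>)"
  proof -
    have "a * \<tau> + S > 0" using pos by (simp add: add_pos_pos)
    then show ?thesis by (simp add: field_simps)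
  qed
  finally have "v \<le> (1 - a * \<tau> / (a * \<tau> + S) * \<eta>) * \<delta>"
    using pos by (simp add: mult_le_cancel_left add_pos_pos not_less)
  then show ?thesis by (simp add: v \<delta>_def)
qed

text \<open>For such steps the quadratic error of the descent estimate uses up at most the fraction
  \<open>1 - \<tau>\<close> of the predicted decrease.\<close>

lemma sufficient_decrease_small_step:
  assumes p: "P x = ereal p" and q: "P (x + d) = ereal q"
    and \<Delta>: "\<gamma> x \<bullet> d + q - p \<le> - (C / 2 * (norm d)\<^sup>2)"
    and "C > 0"
    and \<eta>: "0 \<le> \<eta>" "\<eta> \<le> 1" "\<eta> * K \<le> (1 - \<tau>) * C"
  shows "composite G P (x + \<eta> *\<^sub>R d) \<le> ereal (G x + p + \<eta> * \<tau> * (\<gamma> x \<bullet> d + q - p))"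
proof -
  let ?\<Delta> = "\<gamma> x \<bullet> d + q - p"
  have "\<tau> \<le> 1"
  proof -
    have "0 \<le> (1 - \<tau>) * C" using \<eta> K_nonneg by (meson mult_nonneg_nonneg order_trans)
    then show ?thesis using \<open>C > 0\<close> by (simp add: zero_le_mult_iff)
  qed
  have "K / 2 * \<eta>\<^sup>2 * (norm d)\<^sup>2 = \<eta> / 2 * (\<eta> * K) * (norm d)\<^sup>2"
    by (simp add: power2_eq_square)
  also have "\<dots> \<le> \<eta> / 2 * ((1 - \<tau>) * C) * (norm d)\<^sup>2"
    using \<eta> by (intro mult_right_mono mult_left_mono) auto
  also have "\<dots> = \<eta> * (1 - \<tau>) * (C / 2 * (norm d)\<^sup>2)" by simp
  also have "\<dots> \<le> \<eta> * (1 - \<tau>) * (- ?\<Delta>)"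
    using \<Delta> \<eta> \<open>\<tau> \<le> 1\<close> by (intro mult_left_mono) auto
  finally have "G x + p + \<eta> * ?\<Delta> + K / 2 * \<eta>\<^sup>2 * (norm d)\<^sup>2 \<le> G x + p + \<eta> * \<tau> * ?\<Delta>"
    by (simp add: algebra_simps)
  with composite_segment(1)[OF p q \<eta>(1,2)] show ?thesis
    by (meson ereal_less_eq(3) order_trans)
qed

text \<open>The search terminates because small steps are accepted. The lower bound on the step is
  stated as a product, which stays meaningful for \<open>K = 0\<close> and then forces the full
  step.\<close>

lemma backtracking:
  fixes \<beta> :: real
  assumes p: "P x = ereal p" and q: "P (x + d) = ereal q"
    and \<Delta>: "\<gamma> x \<bullet> d + q - p \<le> - (C / 2 * (norm d)\<^sup>2)"
    and C: "C > 0" and \<beta>: "0 < \<beta>" "\<beta> < 1" and \<tau>: "\<tau> < 1"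
  defines "decr \<equiv> \<lambda>\<eta>. composite G P (x + \<eta> *\<^sub>R d) \<le> ereal (G x + p + \<eta> * \<tau> * (\<gamma> x \<bullet> d + q - p))"
  defines "\<eta> \<equiv> \<beta> ^ (LEAST i. decr (\<beta> ^ i))"
  shows "decr \<eta>" "0 < \<eta>" "\<eta> \<le> 1" "\<eta> = 1 \<or> \<beta> * ((1 - \<tau>) * C) < \<eta> * K"
proof -
  have small: "decr (\<beta> ^ i)" if "\<beta> ^ i * K \<le> (1 - \<tau>) * C" for i
    unfolding decr_def using sufficient_decrease_small_step[OF p q \<Delta> C _ _ that] \<beta>
    by (simp add: power_le_one)
  have "(\<lambda>i. \<beta> ^ i * K) \<longlonglongrightarrow> 0"
    using \<beta> by (auto intro!: tendsto_mult_left_zero LIMSEQ_power_zero)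
  moreover have "0 < (1 - \<tau>) * C" using \<tau> C by simp
  ultimately have "\<forall>\<^sub>F i in sequentially. \<beta> ^ i * K < (1 - \<tau>) * C"
    by (rule order_tendstoD(2))
  then obtain i where "\<beta> ^ i * K < (1 - \<tau>) * C"
    using eventually_happens'[OF sequentially_bot] by blast
  then have "decr (\<beta> ^ i)" using small by simp
  then show "decr \<eta>" unfolding \<eta>_def by (rule LeastI)
  show "0 < \<eta>" "\<eta> \<le> 1" using \<beta> by (auto simp: \<eta>_def power_le_one)
  show "\<eta> = 1 \<or> \<beta> * ((1 - \<tau>) * C) < \<eta> * K"
  proof (cases "LEAST i. decr (\<beta> ^ i)")
    \<comment> \<open>The previous trial step was rejected, hence too long for the small-step
      criterion; the accepted one is shorter by the factor \<beta>.\<close>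
    case (Suc j)
    then have "\<not> decr (\<beta> ^ j)" by (metis lessI not_less_Least)
    then have "(1 - \<tau>) * C < \<beta> ^ j * K" by (meson small not_le)
    then have "\<beta> * ((1 - \<tau>) * C) < \<beta> * (\<beta> ^ j * K)" using \<beta> by simp
    then show ?thesis by (simp add: \<eta>_def Suc)
  qed (simp add: \<eta>_def)
qed

end

subsection \<open>Spectral norm and smallest eigenvalue\<close>

lemma norm_matrix_vector_le:
  fixes A :: "real ^ 'm ^ 'k"
  shows "norm (A *v x) \<le> spectral_norm A * norm x"
  unfolding spectral_norm_def by (rule onorm) simp

lemma spectral_norm_nonneg: "0 \<le> spectral_norm A"
  unfolding spectral_norm_def by (rule onorm_pos_le) simp

lemma inner_matrix_transpose:
  fixes A :: "real ^ 'm ^ 'k"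
  shows "x \<bullet> (A *v y) = (transpose A *v x) \<bullet> y"
  by (simp add: dot_lmul_matrix)

lemma power2_norm_matrix_le:
  fixes X :: "real ^ 'm ^ 'k"
  shows "(norm (X *v d))\<^sup>2 \<le> spectral_norm (transpose X ** X) * (norm d)\<^sup>2"
proof -
  have "(norm (X *v d))\<^sup>2 = d \<bullet> ((transpose X ** X) *v d)"
    unfolding power2_norm_eq_inner inner_matrix_transpose[of "X *v d"]
    by (simp only: matrix_vector_mul_assoc inner_commute[of d])
  also have "\<dots> \<le> norm d * norm ((transpose X ** X) *v d)"
    by (rule norm_cauchy_schwarz)
  also have "\<dots> \<le> norm d * (spectral_norm (transpose X ** X) * norm d)"
    by (intro mult_left_mono norm_matrix_vector_le) auto
  finally show ?thesis by (simp add: power2_eq_square mult_ac)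
qed

text \<open>The squared norm equals \<open>v \<bullet> (X *v (transpose X *v v))\<close>; bounding
  the outer \<open>X\<close> by the Gram matrix avoids comparing the spectral norms of
  \<open>X\<close> and its transpose.\<close>

lemma norm_transpose_matrix_le:
  fixes X :: "real ^ 'm ^ 'k"
  shows "norm (transpose X *v v) \<le> sqrt (spectral_norm (transpose X ** X)) * norm v"
proof -
  let ?k = "sqrt (spectral_norm (transpose X ** X))" and ?n = "norm (transpose X *v v)"
  have "?n * ?n = v \<bullet> (X *v (transpose X *v v))"
    by (simp only: inner_matrix_transpose flip: power2_norm_eq_inner power2_eq_square)
  also have "\<dots> \<le> norm v * norm (X *v (transpose X *v v))"
    by (rule norm_cauchy_schwarz)
  also have "\<dots> \<le> norm v * (?k * ?n)"
    using real_sqrt_le_mono[OF power2_norm_matrix_le[of X "transpose X *v v"]]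
    by (intro mult_left_mono) (auto simp: real_sqrt_mult)
  finally have "?n * ?n \<le> ?n * (?k * norm v)" by (simp add: mult_ac)
  then show ?thesis
    using spectral_norm_nonneg[of "transpose X ** X"]
    by (cases "?n = 0") (auto simp: mult_le_cancel_left)
qed

lemma spectral_norm_gram_pos:
  fixes X :: "real ^ 'm ^ 'k"
  assumes "X \<noteq> 0"
  shows "0 < spectral_norm (transpose X ** X)"
proof (rule ccontr)
  assume "\<not> ?thesis"
  then have "spectral_norm (transpose X ** X) = 0"
    using spectral_norm_nonneg[of "transpose X ** X"] by simp
  then have "X *v d = 0" for d
    using power2_norm_matrix_le[of X d] by simp
  then have "X *v d = 0 *v d" for d by simp
  with assms show False by (metis matrix_eq)
qed

text \<open>Eigenvectors for distinct eigenvalues are orthogonal. Finiteness is what gives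
  \<open>Min\<close> in \<open>smallest_eigenvalue\<close> its lower-bound property.\<close>

lemma finite_eigenvalues_symmetric:
  fixes A :: "real ^ 'k ^ 'k"
  assumes "transpose A = A"
  shows "finite (eigenvalues A)"
proof -
  have "\<forall>c\<in>eigenvalues A. \<exists>v. v \<noteq> 0 \<and> A *v v = c *\<^sub>R v"
    by (auto simp: eigenvalues_def)
  then obtain v where v: "\<And>c. c \<in> eigenvalues A \<Longrightarrow> v c \<noteq> 0 \<and> A *v v c = c *\<^sub>R v c"
    by metis
  have orth: "v c \<bullet> v e = 0" if "c \<in> eigenvalues A" "e \<in> eigenvalues A" "c \<noteq> e" for c e
  proof -
    have "v c \<bullet> (A *v v e) = (A *v v c) \<bullet> v e"
      by (metis inner_matrix_transpose assms)
    then have "e * (v c \<bullet> v e) = c * (v c \<bullet> v e)" using v that by simp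
    then show ?thesis using that by simp
  qed
  have "inj_on v (eigenvalues A)"
    using orth v by (intro inj_onI) (metis inner_eq_zero_iff)
  moreover have "pairwise orthogonal (v ` eigenvalues A)"
    using orth by (auto simp: pairwise_def orthogonal_def)
  then have "finite (v ` eigenvalues A)"
    by (rule pairwise_orthogonal_imp_finite)
  ultimately show ?thesis by (rule finite_imageD[rotated])
qed

lemma eq_0_if_quadratic_form_nonneg:
  fixes a b :: real
  assumes "\<And>t. 0 \<le> t * a + t\<^sup>2 * b"
  shows "a = 0"
proof (rule ccontr)
  assume "a \<noteq> 0"
  \<comment> \<open>The minimizer of \<open>t * a + t\<^sup>2 * (\<bar>b\<bar> + 1)\<close>; the
    added 1 keeps the leading coefficient positive.\<close>
  define t where "t = - a / (2 * (\<bar>b\<bar> + 1))"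
  have "t * a + t\<^sup>2 * b \<le> t * a + t\<^sup>2 * (\<bar>b\<bar> + 1)"
    by (intro add_left_mono mult_left_mono) auto
  also have "\<dots> = - a\<^sup>2 / (4 * (\<bar>b\<bar> + 1))"
    by (simp add: t_def power2_eq_square divide_simps) (simp add: algebra_simps)
  also have "\<dots> < 0" using \<open>a \<noteq> 0\<close> by (simp add: divide_neg_pos)
  finally show False using assms[of t] by simp
qed

text \<open>A minimizer of the Rayleigh quotient on the unit sphere is an eigenvector.\<close>

lemma smallest_eigenvalue_le_rayleigh:
  fixes A :: "real ^ 'k ^ 'k"
  assumes sym: "transpose A = A"
  shows "smallest_eigenvalue A * (norm x)\<^sup>2 \<le> x \<bullet> (A *v x)"
proof -
  have "continuous_on (sphere 0 1) (\<lambda>x. x \<bullet> (A *v x))"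
    by (intro continuous_intros)
  moreover have "sphere 0 (1 :: real) \<noteq> ({} :: (real ^ 'k) set)" by simp
  ultimately obtain v where v: "v \<in> sphere 0 1"
    "\<And>y. y \<in> sphere 0 1 \<Longrightarrow> v \<bullet> (A *v v) \<le> y \<bullet> (A *v y)"
    using continuous_attains_inf[OF compact_sphere, of 0 1 "\<lambda>x. x \<bullet> (A *v x)"] by metis
  define c where "c = v \<bullet> (A *v v)"
  have q: "c * (norm y)\<^sup>2 \<le> y \<bullet> (A *v y)" for y
  proof (cases "y = 0")
    case False
    let ?u = "(1 / norm y) *\<^sub>R y"
    have "c \<le> ?u \<bullet> (A *v ?u)"
      unfolding c_def using False by (intro v(2)) simp
    also have "\<dots> = (y \<bullet> (A *v y)) / (norm y)\<^sup>2"
      by (simp add: matrix_vector_mult_scaleR power2_eq_square)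
    finally show ?thesis using False by (simp add: field_simps)
  qed simp
  \<comment> \<open>The form \<open>y \<bullet> (A *v y) - c * (norm y)\<^sup>2\<close> is
    nonnegative and vanishes at \<open>v\<close>. Perturbing \<open>v\<close> along the residual
    itself makes the linear coefficient twice the squared residual norm.\<close>
  have "A *v v - c *\<^sub>R v = 0"
  proof -
    let ?r = "A *v v - c *\<^sub>R v"
    have "0 \<le> t * (2 * (?r \<bullet> ?r)) + t\<^sup>2 * (?r \<bullet> (A *v ?r) - c * (norm ?r)\<^sup>2)" for t
    proof -
      define r where "r = ?r"
      have "v \<bullet> (A *v r) = r \<bullet> (A *v v)"
        by (metis inner_matrix_transpose sym inner_commute)
      then have 1: "(v + t *\<^sub>R r) \<bullet> (A *v (v + t *\<^sub>R r))
          = c + 2 * t * (r \<bullet> (A *v v)) + t\<^sup>2 * (r \<bullet> (A *v r))"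
        unfolding matrix_vector_right_distrib matrix_vector_mult_scaleR inner_add_left
          inner_add_right inner_scaleR_left inner_scaleR_right c_def
        by (simp add: power2_eq_square algebra_simps)
      have "v \<bullet> v = 1" using v(1) by (simp flip: power2_norm_eq_inner)
      then have 2: "c * (norm (v + t *\<^sub>R r))\<^sup>2 = c + 2 * t * (r \<bullet> (c *\<^sub>R v)) + t\<^sup>2 * (c * (norm r)\<^sup>2)"
        unfolding power2_norm_eq_inner inner_add_left
          inner_add_right inner_scaleR_left inner_scaleR_right inner_commute[of v r]
        by (simp add: power2_eq_square algebra_simps)
      have "0 \<le> 2 * t * (r \<bullet> (A *v v) - r \<bullet> (c *\<^sub>R v)) + t\<^sup>2 * (r \<bullet> (A *v r) - c * (norm r)\<^sup>2)"
        using q[of "v + t *\<^sub>R r"] unfolding 1 2 by (simp add: algebra_simps)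
      then show ?thesis
        unfolding inner_diff_right[symmetric] r_def by (simp only: mult_ac)
    qed
    from eq_0_if_quadratic_form_nonneg[OF this] show ?thesis by simp
  qed
  then have "c \<in> eigenvalues A"
    using v(1) by (auto simp: eigenvalues_def intro!: exI[of _ v])
  then have "smallest_eigenvalue A \<le> c"
    unfolding smallest_eigenvalue_def
    by (rule Min_le[OF finite_eigenvalues_symmetric[OF sym]])
  then have "smallest_eigenvalue A * (norm x)\<^sup>2 \<le> c * (norm x)\<^sup>2"
    by (rule mult_right_mono) simp
  with q[of x] show ?thesis by simp
qed

subsection \<open>The dual objective\<close>

lemma convex_fun_conj_on:
  assumes "\<And>z. h z \<noteq> -\<infinity>"
  shows "convex_fun (conj_on S h)"
  unfolding convex_fun_def
proof (rule convexI)
  fix p q and u v :: real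
  assume "p \<in> epi (conj_on S h)" "q \<in> epi (conj_on S h)" and uv: "0 \<le> u" "0 \<le> v" "u + v = 1"
  then have *: "conj_on S h (fst p) \<le> ereal (snd p)" "conj_on S h (fst q) \<le> ereal (snd q)"
    by (auto simp: epi_def)
  have "conj_on S h (u *\<^sub>R fst p + v *\<^sub>R fst q) \<le> ereal (u * snd p + v * snd q)"
    unfolding conj_on_def
  proof (rule SUP_least)
    fix z assume z: "z \<in> S \<inter> effdom h"
    then obtain r where r: "h z = ereal r"
      using assms[of z] by (cases "h z") (auto simp: effdom_def)
    have "ereal (z \<bullet> fst p - r) \<le> ereal (snd p)" "ereal (z \<bullet> fst q - r) \<le> ereal (snd q)"
      using z *[THEN order_trans[rotated]] conj_on_ge[of z S h r] r by blast+
    then have "u * (z \<bullet> fst p - r) + v * (z \<bullet> fst q - r) \<le> u * snd p + v * snd q"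
      using uv by (intro add_mono mult_left_mono) auto
    moreover have "u * (z \<bullet> fst p - r) + v * (z \<bullet> fst q - r)
        = z \<bullet> (u *\<^sub>R fst p + v *\<^sub>R fst q) - (u + v) * r"
      by (simp add: inner_add_right algebra_simps)
    ultimately show "ereal (z \<bullet> (u *\<^sub>R fst p + v *\<^sub>R fst q)) - h z \<le> ereal (u * snd p + v * snd q)"
      using uv(3) r by simp
  qed
  then show "u *\<^sub>R p + v *\<^sub>R q \<in> epi (conj_on S h)"
    by (cases p; cases q) (simp add: epi_def)
qed

lemma convex_fun_reflect:
  assumes "convex_fun h"
  shows "convex_fun (\<lambda>x. h (- x))"
proof -
  have "linear (\<lambda>p :: 'a \<times> real. (- fst p, snd p))"
    by (intro linearI) auto
  then have "convex ((\<lambda>p. (- fst p, snd p)) -` epi h)"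
    using assms unfolding convex_fun_def by (rule convex_linear_vimage)
  moreover have "(\<lambda>p. (- fst p, snd p)) -` epi h = epi (\<lambda>x. h (- x))"
    by (auto simp: epi_def)
  ultimately show ?thesis by (simp add: convex_fun_def)
qed

lemma sum_blk_proj: "(\<Sum>i\<in>UNIV. blk_proj blk i z) = z"
  for blk :: "'k::finite \<Rightarrow> 'l::finite"
  by (simp add: vec_eq_iff blk_proj_def)

lemma inner_blk_proj: "blk_proj blk i y \<bullet> blk_proj blk i z = blk_proj blk i y \<bullet> z"
  by (auto simp: inner_vec_def blk_proj_def intro!: sum.cong)

lemma blk_proj_in_space: "blk_proj blk i z \<in> blk_space blk i"
  by (simp add: blk_proj_def blk_space_def)

text \<open>Identifies \<Omega>, defined block by block, with the effective domain of the reflected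
  conjugate. Summing the block bounds gives one direction; varying a single block gives the
  other.\<close>

lemma xi_conj_less_PInf_iff:
  fixes blk :: "'k::finite \<Rightarrow> 'l::finite"
  shows "xi_conj blk \<xi> (- \<alpha>) < \<infinity> \<longleftrightarrow> \<alpha> \<in> dual_feasible blk \<xi>"
proof
  assume \<alpha>: "\<alpha> \<in> dual_feasible blk \<xi>"
  let ?c = "\<lambda>i. conj_on (blk_space blk i) (\<lambda>z. ereal (\<xi> i z)) (- blk_proj blk i \<alpha>)"
  have "\<exists>r. ?c i = ereal r" for i
  proof -
    have "?c i < \<infinity>" using \<alpha> by (simp add: dual_feasible_def effdom_def)
    moreover have "ereal (0 \<bullet> (- blk_proj blk i \<alpha>) - \<xi> i 0) \<le> ?c i"
      by (rule conj_on_ge) (auto simp: blk_space_def)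
    ultimately show ?thesis by (cases "?c i") auto
  qed
  then obtain r where r: "\<And>i. ?c i = ereal (r i)" by metis
  have "xi_conj blk \<xi> (- \<alpha>) \<le> ereal (\<Sum>i\<in>UNIV. r i)"
    unfolding xi_conj_def conj_on_def[of UNIV]
  proof (rule SUP_least)
    fix z
    have "blk_proj blk i z \<bullet> (- \<alpha>) - \<xi> i (blk_proj blk i z) \<le> r i" for i
      using conj_on_ge[where h = "\<lambda>z. ereal (\<xi> i z)" and u = "- blk_proj blk i \<alpha>",
          OF blk_proj_in_space[of blk i z] refl]
      by (simp add: r inner_blk_proj)
    then have "(\<Sum>i\<in>UNIV. blk_proj blk i z \<bullet> (- \<alpha>) - \<xi> i (blk_proj blk i z)) \<le> (\<Sum>i\<in>UNIV. r i)"
      by (rule sum_mono)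
    then show "ereal (z \<bullet> (- \<alpha>)) - ereal (xi_sum blk \<xi> z) \<le> ereal (\<Sum>i\<in>UNIV. r i)"
      by (simp only: sum_subtractf inner_sum_left[symmetric] sum_blk_proj xi_sum_def
          ereal_minus ereal_less_eq)
  qed
  then show "xi_conj blk \<xi> (- \<alpha>) < \<infinity>" by (auto simp: less_top[symmetric] dest: top_le)
next
  assume fin: "xi_conj blk \<xi> (- \<alpha>) < \<infinity>"
  have "conj_on (blk_space blk i) (\<lambda>z. ereal (\<xi> i z)) (- blk_proj blk i \<alpha>) < \<infinity>" for i
  proof -
    \<comment> \<open>The constant contributed by the other blocks, frozen at 0.\<close>
    let ?k = "ereal (\<Sum>j\<in>UNIV - {i}. \<xi> j 0)"
    have "conj_on (blk_space blk i) (\<lambda>z. ereal (\<xi> i z)) (- blk_proj blk i \<alpha>) \<le> xi_conj blk \<xi> (- \<alpha>) + ?k"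
      unfolding conj_on_def[of "blk_space blk i"]
    proof (rule SUP_least)
      fix z assume "z \<in> blk_space blk i \<inter> effdom (\<lambda>z. ereal (\<xi> i z))"
      then have z: "blk_proj blk i z = z" "\<And>j. j \<noteq> i \<Longrightarrow> blk_proj blk j z = 0"
        by (auto simp: blk_space_def blk_proj_def vec_eq_iff)
      have "xi_sum blk \<xi> z = \<xi> i z + (\<Sum>j\<in>UNIV - {i}. \<xi> j 0)"
        unfolding xi_sum_def using z by (subst sum.remove[of _ i]) auto
      moreover have "z \<bullet> blk_proj blk i \<alpha> = z \<bullet> \<alpha>"
        using inner_blk_proj[of blk i z \<alpha>] z(1) by simp
      moreover have "ereal (z \<bullet> (- \<alpha>) - xi_sum blk \<xi> z) \<le> xi_conj blk \<xi> (- \<alpha>)"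
        unfolding xi_conj_def by (rule conj_on_ge) auto
      ultimately show "ereal (z \<bullet> (- blk_proj blk i \<alpha>)) - ereal (\<xi> i z) \<le> xi_conj blk \<xi> (- \<alpha>) + ?k"
        by (cases "xi_conj blk \<xi> (- \<alpha>)") auto
    qed
    also have "\<dots> < \<infinity>" using fin by (cases "xi_conj blk \<xi> (- \<alpha>)") auto
    finally show ?thesis .
  qed
  then show "\<alpha> \<in> dual_feasible blk \<xi>"
    by (simp add: dual_feasible_def effdom_def)
qed

lemma xi_conj_not_MInf: "xi_conj blk \<xi> u \<noteq> -\<infinity>"
proof -
  have "ereal (0 \<bullet> u - xi_sum blk \<xi> 0) \<le> xi_conj blk \<xi> u"
    unfolding xi_conj_def by (rule conj_on_ge) auto
  then show ?thesis by auto
qed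

text \<open>The sum of two Fenchel-Young inequalities. It keeps the dual optimal value away from
  minus infinity.\<close>

lemma weak_duality:
  assumes "primal g blk \<xi> X w = ereal r"
  shows "ereal (- r) \<le> dual g blk \<xi> X \<alpha>"
proof -
  let ?x = "xi_sum blk \<xi> (transpose X *v w)"
  have gw: "g w = ereal (r - ?x)"
    using assms by (cases "g w") (auto simp: primal_def xi_sum_def)
  have "ereal (w \<bullet> (X *v \<alpha>) - (r - ?x)) \<le> Gstar g X \<alpha>"
    unfolding Gstar_def by (rule conj_on_ge[where h = g, OF UNIV_I gw])
  moreover have "ereal ((transpose X *v w) \<bullet> (- \<alpha>) - ?x) \<le> xi_conj blk \<xi> (- \<alpha>)"
    unfolding xi_conj_def by (rule conj_on_ge) auto
  ultimately have "ereal (w \<bullet> (X *v \<alpha>) - (r - ?x)) + ereal ((transpose X *v w) \<bullet> (- \<alpha>) - ?x)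
      \<le> dual g blk \<xi> X \<alpha>"
    unfolding dual_def by (rule add_mono)
  then show ?thesis by (simp add: inner_matrix_transpose)
qed

text \<open>Either regularity alternative gives continuity, through which closedness passes from the
  primal objective to \<open>g\<close>.\<close>

lemma continuous_xi_sum:
  assumes "(\<exists>\<rho>>0. lipschitz_smooth \<rho> (xi_sum blk \<xi>)) \<or> (\<exists>L>0. L-lipschitz_on UNIV (xi_sum blk \<xi>))"
  shows "continuous_on UNIV (xi_sum blk \<xi>)"
  using assms
proof
  assume "\<exists>\<rho>>0. lipschitz_smooth \<rho> (xi_sum blk \<xi>)"
  then obtain D where "\<And>z. GDERIV (xi_sum blk \<xi>) z :> D z"
    unfolding lipschitz_smooth_def by blast
  then have "isCont (xi_sum blk \<xi>) z" for z
    unfolding gderiv_def by (rule has_derivative_continuous)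
  then show ?thesis by (simp add: continuous_on_eq_continuous_at)
qed (auto intro: lipschitz_on_continuous_on)

text \<open>\<open>\<parallel>X d\<parallel>\<^sup>2 = d \<bullet> (X\<^sup>T X) d\<close> is bounded by the norm of the Gram matrix, which is how
  the latter enters the rate.\<close>

lemma composite_dual:
  fixes g :: "real ^ 'n \<Rightarrow> ereal" and X :: "real ^ 'k::finite ^ 'n"
    and blk :: "'k \<Rightarrow> 'l::finite"
  assumes "\<sigma> > 0" "strongly_convex_fun \<sigma> g" "closed_fun g" "proper_fun g"
  obtains G where "\<And>\<alpha>. Gstar g X \<alpha> = ereal (G \<alpha>)"
    "smooth_plus_convex G (grad_Gstar g X) (spectral_norm (transpose X ** X) / \<sigma>)
      (\<lambda>\<alpha>. xi_conj blk \<xi> (- \<alpha>))"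
proof -
  obtain h w where h: "\<And>u. conjugate g u = ereal (h u)"
    and lower: "\<And>u v. h u + w u \<bullet> (v - u) \<le> h v"
    and upper: "\<And>u v. h v \<le> h u + w u \<bullet> (v - u) + (norm (v - u))\<^sup>2 / (2 * \<sigma>)"
    and lip: "\<And>u v. norm (w u - w v) \<le> norm (u - v) / \<sigma>"
    using strongly_convex_conjugate[OF assms] by metis
  let ?K = "spectral_norm (transpose X ** X)"
  define G where "G \<alpha> = h (X *v \<alpha>)" for \<alpha>
  define \<gamma> where "\<gamma> \<alpha> = transpose X *v w (X *v \<alpha>)" for \<alpha>
  have G: "Gstar g X \<alpha> = ereal (G \<alpha>)" for \<alpha>
    by (simp add: Gstar_def G_def h)
  have inner: "w (X *v x) \<bullet> (X *v y - X *v x) = \<gamma> x \<bullet> (y - x)" for x y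
    unfolding \<gamma>_def inner_matrix_transpose[symmetric] by (simp only: matrix_vector_mult_diff_distrib)
  have sc: "smooth_plus_convex G \<gamma> (?K / \<sigma>) (\<lambda>\<alpha>. xi_conj blk \<xi> (- \<alpha>))"
    unfolding smooth_plus_convex_def
  proof (intro conjI allI)
    fix x y
    show "G x + \<gamma> x \<bullet> (y - x) \<le> G y"
      using lower[of "X *v x" "X *v y"] unfolding inner by (simp add: G_def)
    have "(norm (X *v y - X *v x))\<^sup>2 / (2 * \<sigma>) \<le> ?K * (norm (y - x))\<^sup>2 / (2 * \<sigma>)"
      using power2_norm_matrix_le[of X "y - x"] assms(1)
      by (intro divide_right_mono) (auto simp: matrix_vector_mult_diff_distrib)
    then show "G y \<le> G x + \<gamma> x \<bullet> (y - x) + ?K / \<sigma> / 2 * (norm (y - x))\<^sup>2"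
      using upper[of "X *v y" "X *v x"] unfolding inner by (simp add: G_def mult.commute)
    \<comment> \<open>One factor \<open>sqrt ?K\<close> comes from the transpose outside
      \<open>w\<close>, a second one from \<open>X\<close> inside.\<close>
    have "norm (\<gamma> x - \<gamma> y) \<le> sqrt ?K * norm (w (X *v x) - w (X *v y))"
      using norm_transpose_matrix_le[of X "w (X *v x) - w (X *v y)"]
      unfolding \<gamma>_def matrix_vector_mult_diff_distrib .
    also have "\<dots> \<le> sqrt ?K * (norm (X *v x - X *v y) / \<sigma>)"
      using spectral_norm_nonneg by (intro mult_left_mono lip) auto
    also have "\<dots> \<le> sqrt ?K * (sqrt ?K * norm (x - y) / \<sigma>)"
      using real_sqrt_le_mono[OF power2_norm_matrix_le[of X "x - y"]] assms(1)
        spectral_norm_nonneg[of "transpose X ** X"]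
      by (intro mult_left_mono divide_right_mono)
         (auto simp: real_sqrt_mult matrix_vector_mult_diff_distrib)
    also have "\<dots> = ?K / \<sigma> * norm (x - y)"
      using spectral_norm_nonneg[of "transpose X ** X"] by simp
    finally show "norm (\<gamma> x - \<gamma> y) \<le> ?K / \<sigma> * norm (x - y)" .
  next
    show "0 \<le> ?K / \<sigma>" using spectral_norm_nonneg[of "transpose X ** X"] assms(1) by simp
    show "convex_fun (\<lambda>\<alpha>. xi_conj blk \<xi> (- \<alpha>))"
      unfolding xi_conj_def by (intro convex_fun_reflect convex_fun_conj_on) simp
    show "xi_conj blk \<xi> (- x) \<noteq> -\<infinity>" for x by (rule xi_conj_not_MInf)
  qed
  have "grad_Gstar g X = \<gamma>"
    by (rule ext) (simp add: grad_Gstar_def G gradient_G[OF sc])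
  with G sc that show thesis by metis
qed

subsection \<open>Linear convergence\<close>

theorem theorem1:
  fixes g :: "real ^ 'n \<Rightarrow> ereal"
    and blk :: "'k::finite \<Rightarrow> 'l::finite"
    and \<xi> :: "'l \<Rightarrow> real ^ 'k \<Rightarrow> real"
    and X :: "real ^ 'k ^ 'n"
    and \<sigma> \<beta> \<tau> \<mu> C\<^sub>1 C\<^sub>2 C\<^sub>3 :: real
    and \<alpha> d :: "nat \<Rightarrow> real ^ 'k"
    and B :: "nat \<Rightarrow> real ^ 'k ^ 'k"
    and \<eta> :: "nat \<Rightarrow> real"
  assumes blocks: "surj blk"
    and sigma: "\<sigma> > 0"
    and g_strong: "strongly_convex_fun \<sigma> g"
    and xi_convex: "\<And>i. convex_on (blk_space blk i) (\<xi> i)"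
    and primal_fun: "proper_fun (primal g blk \<xi> X)" "closed_fun (primal g blk \<xi> X)"
      "convex_fun (primal g blk \<xi> X)"
    and primal_sol: "\<exists>w. is_arg_min (primal g blk \<xi> X) (\<lambda>_. True) w"
    and xi_regular: "(\<exists>\<rho>>0. lipschitz_smooth \<rho> (xi_sum blk \<xi>))
      \<or> (\<exists>L>0. L-lipschitz_on UNIV (xi_sum blk \<xi>))"
    and params: "0 < \<beta>" "\<beta> < 1" "0 < \<tau>" "\<tau> < 1"
    and start: "\<alpha> 0 \<in> dual_feasible blk \<xi>"
    and B_sym: "\<And>t. transpose (B t) = B t"
    and direction: "\<And>t. is_arg_min (Qsub g blk \<xi> X (B t) (\<alpha> t)) (\<lambda>_. True) (d t)"
    and update: "\<And>t. \<alpha> (Suc t) = \<alpha> t + \<eta> t *\<^sub>R d t"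
    and line_search: "(\<forall>t. \<eta> t = backtracking_step g blk \<xi> X \<beta> \<tau> (\<alpha> t) (d t))
      \<or> (\<forall>t. exact_step g blk \<xi> X (\<alpha> t) (d t) (\<eta> t))"
    and KL: "\<mu> > 0" "KL_half g blk \<xi> X \<mu>"
    and B_bound: "C\<^sub>3 > 0" "\<And>t. spectral_norm (B t) \<le> C\<^sub>3"
    and constants: "C\<^sub>1 \<le> C\<^sub>3" "C\<^sub>2 > 0" "C\<^sub>1 + C\<^sub>2 > 0"
    and B_eig: "\<And>t. C\<^sub>1 \<le> smallest_eigenvalue (B t)"
    and Q_strong: "\<And>t. strongly_convex_fun C\<^sub>2 (Qsub g blk \<xi> X (B t) (\<alpha> t))"
  shows "(\<lambda>t. dual g blk \<xi> X (\<alpha> t)) \<longlonglongrightarrow> dual_opt g blk \<xi> X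
    \<and> (\<forall>t. dual g blk \<xi> X (\<alpha> (Suc t)) - dual_opt g blk \<xi> X
        \<le> ereal (1 - \<mu> * (C\<^sub>1 + C\<^sub>2) * \<tau>
              / (\<mu> * (C\<^sub>1 + C\<^sub>2) * \<tau>
                 + 2 * ((spectral_norm (transpose X ** X))\<^sup>2 / \<sigma>\<^sup>2 + C\<^sub>3\<^sup>2))
              * (if X = 0 then 1
                 else min 1 (\<beta> * (1 - \<tau>) * \<sigma> * (C\<^sub>1 + C\<^sub>2)
                   / spectral_norm (transpose X ** X))))
          * (dual g blk \<xi> X (\<alpha> t) - dual_opt g blk \<xi> X))"
proof -

  \<comment> \<open>Constants: \<kappa> is the claimed contraction factor and \<open>m\<close> a
    lower bound for the backtracking step\<close>
  define K where "K = spectral_norm (transpose X ** X)"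
  define C where "C = C\<^sub>1 + C\<^sub>2"
  define S where "S = 2 * (K\<^sup>2 / \<sigma>\<^sup>2 + C\<^sub>3\<^sup>2)"
  define a where "a = \<mu> * C"
  define m where "m = (if X = 0 then 1 else min 1 (\<beta> * (1 - \<tau>) * \<sigma> * C / K))"
  define \<kappa> where "\<kappa> = 1 - a * \<tau> / (a * \<tau> + S) * m"
  have C: "C > 0" and a: "a > 0" and S: "S > 0"
    using constants KL(1) B_bound(1) by (auto simp: C_def a_def S_def add_nonneg_pos)
  then have \<lambda>: "0 < a * \<tau> / (a * \<tau> + S)" "a * \<tau> / (a * \<tau> + S) < 1"
    using params by (simp_all add: add_pos_pos divide_simps)
  have "0 < m" "m \<le> 1"
    using params C sigma spectral_norm_gram_pos[of X] by (auto simp: m_def K_def)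
  then have "0 < a * \<tau> / (a * \<tau> + S) * m" "a * \<tau> / (a * \<tau> + S) * m \<le> 1"
    using \<lambda> by (simp_all only: mult_pos_pos mult_le_one less_imp_le)
  then have \<kappa>: "0 \<le> \<kappa>" "\<kappa> < 1" by (simp_all add: \<kappa>_def)

  have g_fin: "g w \<noteq> -\<infinity>" for w
    using primal_fun(1) by (auto simp: proper_fun_def primal_def dest: spec[of _ w])
  obtain w\<^sub>0 r where w\<^sub>0: "primal g blk \<xi> X w\<^sub>0 = ereal r"
    using primal_fun(1) unfolding proper_fun_def by (metis ereal_cases)
  have "proper_fun g"
    using g_fin w\<^sub>0 unfolding proper_fun_def primal_def by (metis plus_ereal.simps(2) PInfty_neq_ereal(1))
  \<comment> \<open>\<open>g\<close> is the primal objective minus a continuous real-valued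
    function.\<close>
  moreover have "closed_fun g"
  proof -
    have "continuous_on UNIV (\<lambda>w. - xi_sum blk \<xi> (transpose X *v w))"
      by (intro continuous_intros continuous_on_compose2[OF continuous_xi_sum[OF xi_regular]]) auto
    from closed_fun_add_continuous[OF primal_fun(2) this] show ?thesis
      by (simp add: primal_def xi_sum_def add.assoc)
  qed
  ultimately obtain G where G: "\<And>\<alpha>. Gstar g X \<alpha> = ereal (G \<alpha>)"
    and sc: "smooth_plus_convex G (grad_Gstar g X) (K / \<sigma>) (\<lambda>\<alpha>. xi_conj blk \<xi> (- \<alpha>))"
    using composite_dual[OF sigma g_strong] unfolding K_def by metis
  let ?P = "\<lambda>\<alpha>. xi_conj blk \<xi> (- \<alpha>)"
  let ?f = "composite G ?P" and ?model = "model (grad_Gstar g X) ?P"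
  have dual: "dual g blk \<xi> X = ?f"
    by (rule ext) (simp add: dual_def composite_def G)
  have model: "Qsub g blk \<xi> X (B t) x d = ?model ((*v) (B t)) x d" for t x d
    by (simp add: Qsub_def model_def)

  have feas: "?f x < \<infinity> \<longleftrightarrow> x \<in> dual_feasible blk \<xi>" for x
    unfolding xi_conj_less_PInf_iff[symmetric] by (cases "?P x") (simp_all add: composite_def)
  \<comment> \<open>The optimal value is finite: weak duality bounds it from below, the feasible
    starting point from above.\<close>
  have "ereal (- r) \<le> dual_opt g blk \<xi> X"
    unfolding dual_opt_def by (intro INF_greatest weak_duality[OF w\<^sub>0])
  moreover have opt_le: "dual_opt g blk \<xi> X \<le> ?f x" if "x \<in> dual_feasible blk \<xi>" for x
    unfolding dual_opt_def dual using that by (rule INF_lower)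
  moreover have "?f (\<alpha> 0) < \<infinity>" using start feas by blast
  ultimately obtain F where F: "dual_opt g blk \<xi> X = ereal F"
    using start by (cases "dual_opt g blk \<xi> X") force+

  \<comment> \<open>Contraction of the gap in one iteration\<close>
  have step: "?f (\<alpha> (Suc t)) \<le> ereal (F + \<kappa> * (v - F))" if v: "?f (\<alpha> t) = ereal v" for t v
  proof -
    let ?x = "\<alpha> t" and ?d = "d t" and ?H = "(*v) (B t)"
    obtain p where p: "?P ?x = ereal p"
      using v by (cases "?P ?x") (auto simp: composite_def)
    have vp: "v = G ?x + p" using v p by (simp add: composite_def)
    have min: "?model ?H ?x ?d \<le> ?model ?H ?x y" for y
      using direction[of t] by (simp add: is_arg_min_def model not_less)
    have sym: "y \<bullet> (B t *v z) = (B t *v y) \<bullet> z" for y z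
      using inner_matrix_transpose[of y "B t" z] B_sym by simp
    have q': "?P (?x + ?d) \<noteq> \<infinity>"
      using min[of 0] by (auto simp: model_def p)
    then obtain Q where "?model ?H ?x ?d = ereal Q"
      using P_not_MInf[OF sc, of "?x + ?d"] by (cases "?P (?x + ?d)") (auto simp: model_def)
    then have "?model ?H ?x ?d + ereal (C\<^sub>2 / 2 * (norm ?d)\<^sup>2) \<le> ?model ?H ?x 0"
      using strongly_convex_min_growth[OF Q_strong, of t ?d Q 0] min by (simp add: model)
    moreover have "C\<^sub>1 * (norm ?d)\<^sup>2 \<le> ?d \<bullet> (B t *v ?d)"
      using smallest_eigenvalue_le_rayleigh[OF B_sym, of t ?d] mult_right_mono[OF B_eig, of "(norm ?d)\<^sup>2" t]
      by simp
    ultimately obtain q where q: "?P (?x + ?d) = ereal q"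
      and \<Delta>: "grad_Gstar g X ?x \<bullet> ?d + q - p \<le> - (C / 2 * (norm ?d)\<^sup>2)"
      unfolding C_def by (rule model_min_decrease[OF sc p])
    let ?\<Delta> = "grad_Gstar g X ?x \<bullet> ?d + q - p"
    have gap: "a * (G (?x + ?d) + q - F) \<le> - (S * ?\<Delta>)"
      unfolding a_def S_def power_divide[symmetric]
    proof (rule gap_at_model_min[OF sc, where H = ?H])
      show "norm (B t *v ?d) \<le> C\<^sub>3 * norm ?d"
        using norm_matrix_vector_le[of "B t" ?d] mult_right_mono[OF B_bound(2), of "norm ?d" t] by simp
      \<comment> \<open>The infimum in the Kurdyka-Lojasiewicz inequality is bounded by its value at
        this one subgradient.\<close>
      fix s assume "s \<in> subdifferential ?f (?x + ?d)"
      then have "(INF s\<in>subdifferential ?f (?x + ?d). ereal ((norm s)\<^sup>2)) / ereal (2 * \<mu>)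
          \<le> ereal ((norm s)\<^sup>2) / ereal (2 * \<mu>)"
        using KL(1) by (intro ereal_divide_right_mono INF_lower) auto
      moreover have "?x + ?d \<in> dual_feasible blk \<xi>"
        using q by (simp add: composite_def flip: feas)
      ultimately have "?f (?x + ?d) - ereal F \<le> ereal ((norm s)\<^sup>2) / ereal (2 * \<mu>)"
        using KL(2) unfolding KL_half_def dual F by (blast intro: order_trans)
      then show "?f (?x + ?d) \<le> ereal (F + (norm s)\<^sup>2 / (2 * \<mu>))"
        unfolding composite_def q using KL(1) by (simp add: algebra_simps)
    qed (use min q \<Delta> C KL(1) sym in auto)

    define decr where "decr \<eta> \<longleftrightarrow> ?f (?x + \<eta> *\<^sub>R ?d) \<le> ereal (G ?x + p + \<eta> * \<tau> * ?\<Delta>)" for \<eta>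
    have armijo: "armijo g blk \<xi> X \<tau> ?x ?d = decr"
      using q by (intro ext) (simp add: armijo_def decr_def dual Delta_def composite_def p)
    \<comment> \<open>The step backtracking would take, considered for both variants as the
      reference for the exact step.\<close>
    define b where "b = backtracking_step g blk \<xi> X \<beta> \<tau> ?x ?d"
    have b: "decr b" "0 < b" "b \<le> 1" "b = 1 \<or> \<beta> * ((1 - \<tau>) * C) < b * (K / \<sigma>)"
      using backtracking[OF sc p q \<Delta> C params(1,2,4)]
      unfolding b_def backtracking_step_def armijo decr_def by blast+
    \<comment> \<open>If \<open>b\<close> is not 1, its lower bound forces \<open>K > 0\<close>,
      hence \<open>X \<noteq> 0\<close>, and the quotient in \<open>m\<close> is a genuine
      one.\<close>
    have "m \<le> b"
    proof (cases "b = 1")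
      case False
      then have *: "\<beta> * ((1 - \<tau>) * C) < b * (K / \<sigma>)" using b by blast
      have "0 < \<beta> * ((1 - \<tau>) * C)" using params C by simp
      with * have "0 < b * (K / \<sigma>)" by simp
      then have "K > 0" using b sigma by (simp add: zero_less_mult_iff zero_less_divide_iff)
      moreover have "K = 0" if "X = 0"
      proof -
        have "transpose X ** X = 0" using that by (simp add: matrix_matrix_mult_def vec_eq_iff)
        moreover have "(*v) (0 :: real ^ 'k ^ 'k) = (\<lambda>_. 0)" by (rule ext) simp
        ultimately show ?thesis by (simp add: K_def spectral_norm_def onorm_zero)
      qed
      moreover have "\<beta> * (1 - \<tau>) * \<sigma> * C / K < b" if "K > 0"
        using * that sigma by (simp add: field_simps)
      ultimately show ?thesis by (auto simp: m_def)
    qed (use \<open>m \<le> 1\<close> in simp)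

    have "?f (\<alpha> (Suc t)) \<le> ?f (?x + b *\<^sub>R ?d)"
      using line_search
    proof
      assume "\<forall>t. exact_step g blk \<xi> X (\<alpha> t) (d t) (\<eta> t)"
      then show ?thesis
        by (simp add: update exact_step_def is_arg_min_def dual not_less)
    qed (simp add: update b_def)
    also have "\<dots> \<le> ereal (F + (1 - a * \<tau> / (a * \<tau> + S) * b) * (G ?x + p - F))"
      using sufficient_decrease_contraction[OF sc p q _ _ gap a S params(3)] b
      unfolding decr_def by simp
    also have "\<dots> \<le> ereal (F + \<kappa> * (v - F))"
    proof -
      have "ereal F \<le> ereal v"
        using opt_le[of ?x] v feas[of ?x] by (simp add: F)
      then have "0 \<le> v - F" by simp
      moreover have "a * \<tau> / (a * \<tau> + S) * m \<le> a * \<tau> / (a * \<tau> + S) * b"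
        using \<open>m \<le> b\<close> \<lambda>(1) by (simp only: mult_left_mono less_imp_le)
      then have "1 - a * \<tau> / (a * \<tau> + S) * b \<le> \<kappa>" unfolding \<kappa>_def by linarith
      ultimately have "(1 - a * \<tau> / (a * \<tau> + S) * b) * (v - F) \<le> \<kappa> * (v - F)"
        by (rule mult_right_mono[rotated])
      then show ?thesis by (simp add: vp)
    qed
    finally show ?thesis .
  qed

  \<comment> \<open>Iteration of the estimate on finite values, giving geometric decay\<close>
  have "\<exists>v. ?f (\<alpha> t) = ereal v" for t
  proof (induction t)
    case 0
    then show ?case
      using \<open>?f (\<alpha> 0) < \<infinity>\<close> opt_le[OF start] by (cases "?f (\<alpha> 0)") (auto simp: F)
  next
    case (Suc t)
    then obtain v where "?f (\<alpha> t) = ereal v" by blast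
    from step[OF this] show ?case
      using P_not_MInf[OF sc, of "\<alpha> (Suc t)"] by (cases "?P (\<alpha> (Suc t))") (auto simp: composite_def)
  qed
  then obtain v where v: "\<And>t. ?f (\<alpha> t) = ereal (v t)" by metis
  have vF: "F \<le> v t" for t
    using opt_le[of "\<alpha> t"] feas[of "\<alpha> t"] by (simp add: F v)
  have rate: "v (Suc t) - F \<le> \<kappa> * (v t - F)" for t
    using step[OF v, of t] by (simp add: v)
  have geometric: "v t - F \<le> \<kappa> ^ t * (v 0 - F)" for t
  proof (induction t)
    case (Suc t)
    have "v (Suc t) - F \<le> \<kappa> * (v t - F)" by (rule rate)
    also have "\<dots> \<le> \<kappa> * (\<kappa> ^ t * (v 0 - F))" using Suc \<kappa>(1) by (rule mult_left_mono)
    finally show ?case by (simp add: mult.assoc)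
  qed simp
  have "(\<lambda>t. v t - F) \<longlonglongrightarrow> 0"
  proof (rule tendsto_sandwich[where f = "\<lambda>_. 0"])
    show "(\<lambda>t. \<kappa> ^ t * (v 0 - F)) \<longlonglongrightarrow> 0"
      using \<kappa> by (auto intro!: tendsto_mult_left_zero LIMSEQ_power_zero)
  qed (use geometric vF in \<open>auto intro!: always_eventually\<close>)
  then have "(\<lambda>t. ereal (v t)) \<longlonglongrightarrow> ereal F"
    by (simp add: LIM_zero_iff)
  then show ?thesis
    using rate unfolding dual F v K_def[symmetric] C_def[symmetric] S_def[symmetric]
      a_def[symmetric] m_def[symmetric] \<kappa>_def[symmetric] by simp
qed

end
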